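(* In the setting of fluctuation geometry described in the context (Axioms 1--4), the distribution function $dp(I|\theta)=\exp[\mathcal{S}(I|\theta)]\,d\mu(I|\theta)$ can be expressed in the Riemannian gaussian representation $$dp(I|\theta)=\frac{1}{\mathcal{Z}(\theta)}\exp\left[-\frac{1}{2}\ell^{2}(I)\right]d\mu(I|\theta),$$ where $\ell(I)=\mathfrak{D}_\theta(I,\bar I)$ is the Riemannian distance between $I$ and the point $\bar I$ of maximum information potential. Consequently, the knowledge of the metric tensor $g_{ij}(I|\theta)$ and of the point $\bar I$ fully determines the distribution function $dp(I|\theta)$.
   Context: Setting. $\theta$ is a fixed value of the control parameters. $\mathcal{M}_\theta$ is the $n$-dimensional manifold of admissible values of continuous stochastic variables $I=(I^1,\dots,I^n)$; it is a simply connected domain. $dp(I|\theta)=\rho(I|\theta)\,dI$ is a probability distribution on $\mathcal{M}_\theta$ with finite, differentiable density. All functions are assumed differentiable as often as needed. Summation over repeated indices is understood. Axiom 1. $\mathcal{M}_\theta$ has a Riemannian structure: a metric tensor $g_{ij}(I|\theta)$ and a torsionless covariant differentiation $D_i$ with $D_kg_{ij}=0$ (so $D$ is the Levi-Civita connection). The determinant of $g_{ij}$ vanishes nowhere. The invariant volume element is $d\mu(I|\theta)=\sqrt{|g_{ij}(I|\theta)/2\pi|}\,dI$, where $|g_{ij}/2\pi|$ is the absolute value of the determinant of the matrix $g_{ij}/2\pi$. Axiom 2. There is a differentiable scalar function $\mathcal{S}(I|\theta)$ on $\mathcal{M}_\theta$ (the information potential) with $dp(I|\theta)=\exp[\mathcal{S}(I|\theta)]\,d\mu(I|\theta)$.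 Axiom 3. A curve $I(t)$ has unitary affine parametrization if $g_{ij}[I(t)|\theta]\dot I^i(t)\dot I^j(t)=1$; a geodesic is a curve of minimal length between two points; the information dissipation along a curve $I(t)$ with unitary affine parametrization is $\Phi(t)=\frac{d}{dt}\mathcal{S}[I(t)|\theta]$. The axiom states: for every geodesic $I_g(t)$ with unitary affine parametrization and every interval $(t_1,t_2)$ of it, the length $\Delta s$ of that interval satisfies $\Delta s=\Phi(t_1)-\Phi(t_2)$. Axiom 4. If $\mathcal{M}_\theta$ is not a closed manifold ($\partial\mathcal{M}_\theta\neq\emptyset$), then $\rho(I|\theta)$ and its first partial derivatives tend to zero as $I$ tends to any point of $\partial\mathcal{M}_\theta$. Here $\partial\mathcal{M}_\theta$ is not part of the (open) domain and includes points at infinity, so tending to the boundary means leaving every compact subset of $\mathcal{M}_\theta$. Since the metric determinant is non-vanishing everywhere, including on the boundary, the probability weight $\omega(I|\theta)=\exp[\mathcal{S}(I|\theta)]=\rho(I|\theta)/\sqrt{|g_{ij}(I|\theta)/2\pi|}$ also tends to zero there. Further notation. $\bar I$ is the unique stationary point of $\mathcal{S}(\cdot|\theta)$, which is its global maximum. $\mathfrak{D}_\theta(P,Q)$ is the Riemannian distance (length of the geodesic joining $P$ and $Q$). With $\psi_i=-\partial\mathcal{S}/\partial I^i$ and $\psi^2=g^{ij}\psi_i\psi_j$, the gaussian potential $\mathcal{P}(\theta)$ is the $I$-independent value of $\mathcal{S}(I|\theta)+\frac12\psi^2(I|\theta)$, and the gaussian partition function $\mathcal{Z}(\theta)$ is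 defined by $\mathcal{P}(\theta)=-\log\mathcal{Z}(\theta)$. *)

theory Defs
  imports "HOL-Probability.Probability"
begin

definition partial_deriv :: "'n \<Rightarrow> (real ^ 'n \<Rightarrow> real) \<Rightarrow> real ^ 'n \<Rightarrow> real" where
  "partial_deriv i f x = frechet_derivative f (at x) (axis i 1)"

text \<open>Only meant for open \<open>M\<close>, where differentiability within \<open>M\<close> is ordinary differentiability.\<close>

primrec Ck_on :: "nat \<Rightarrow> (real ^ 'n) set \<Rightarrow> (real ^ 'n \<Rightarrow> real) \<Rightarrow> bool" where
  "Ck_on 0 M f \<longleftrightarrow> continuous_on M f"
| "Ck_on (Suc k) M f \<longleftrightarrow> f differentiable_on M \<and> (\<forall>i. Ck_on k M (partial_deriv i f))"

definition smooth_fun_on :: "(real ^ 'n) set \<Rightarrow> (real ^ 'n \<Rightarrow> real) \<Rightarrow> bool" where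
  "smooth_fun_on M f \<longleftrightarrow> (\<forall>k. Ck_on k M f)"

text \<open>The manifold is a domain \<open>M\<close> of coordinate space; \<open>g x $ i $ j\<close> is $g_{ij}(x)$.\<close>

definition metric_form :: "(real ^ 'n \<Rightarrow> real ^ 'n ^ 'n) \<Rightarrow> real ^ 'n \<Rightarrow> real ^ 'n \<Rightarrow> real ^ 'n \<Rightarrow> real" where
  "metric_form g x u v = u \<bullet> (g x *v v)"

definition riemannian_metric_on :: "(real ^ 'n) set \<Rightarrow> (real ^ 'n \<Rightarrow> real ^ 'n ^ 'n) \<Rightarrow> bool" where
  "riemannian_metric_on M g \<longleftrightarrow>
     (\<forall>i j. smooth_fun_on M (\<lambda>x. g x $ i $ j)) \<and>
     (\<forall>x\<in>M. transpose (g x) = g x \<and> (\<forall>v. v \<noteq> 0 \<longrightarrow> metric_form g x v v > 0) \<and> det (g x) \<noteq> 0)"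

text \<open>\<open>\<Gamma> m i j\<close> is the connection coefficient $\Gamma^m_{ij}$; the two equations say that the
  covariant differentiation is torsionless and that $D_k g_{ij} = 0$.\<close>

definition levi_civita_on ::
  "(real ^ 'n) set \<Rightarrow> (real ^ 'n \<Rightarrow> real ^ 'n ^ 'n) \<Rightarrow> ('n \<Rightarrow> 'n \<Rightarrow> 'n \<Rightarrow> real ^ 'n \<Rightarrow> real) \<Rightarrow> bool" where
  "levi_civita_on M g \<Gamma> \<longleftrightarrow>
     (\<forall>m i j. smooth_fun_on M (\<Gamma> m i j)) \<and>
     (\<forall>x\<in>M. \<forall>m i j. \<Gamma> m i j x = \<Gamma> m j i x) \<and>
     (\<forall>x\<in>M. \<forall>k i j. partial_deriv k (\<lambda>y. g y $ i $ j) x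
        - (\<Sum>m\<in>UNIV. \<Gamma> m k i x * g x $ m $ j) - (\<Sum>m\<in>UNIV. \<Gamma> m k j x * g x $ i $ m) = 0)"

definition volume_density :: "(real ^ 'n \<Rightarrow> real ^ 'n ^ 'n) \<Rightarrow> real ^ 'n \<Rightarrow> real" where
  "volume_density g x = sqrt \<bar>det ((1 / (2 * pi)) *\<^sub>R g x)\<bar>"

definition invariant_volume :: "(real ^ 'n) set \<Rightarrow> (real ^ 'n \<Rightarrow> real ^ 'n ^ 'n) \<Rightarrow> (real ^ 'n) measure" where
  "invariant_volume M g = density (restrict_space lborel M) (\<lambda>x. ennreal (volume_density g x))"

definition speed :: "(real ^ 'n \<Rightarrow> real ^ 'n ^ 'n) \<Rightarrow> (real \<Rightarrow> real ^ 'n) \<Rightarrow> real \<Rightarrow> real" where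
  "speed g \<gamma> t = sqrt (metric_form g (\<gamma> t) (vector_derivative \<gamma> (at t)) (vector_derivative \<gamma> (at t)))"

definition arc_length :: "(real ^ 'n \<Rightarrow> real ^ 'n ^ 'n) \<Rightarrow> (real \<Rightarrow> real ^ 'n) \<Rightarrow> real \<Rightarrow> real \<Rightarrow> real" where
  "arc_length g \<gamma> a b = integral {a..b} (speed g \<gamma>)"

text \<open>The predicate \<open>piecewise_C1_differentiable_on\<close> allows an unbounded derivative near the
  exceptional points. Integrability of the speed excludes curves of infinite length, to which
  \<^const>\<open>arc_length\<close> would assign the value 0.\<close>

definition admissible_curve ::
  "(real ^ 'n) set \<Rightarrow> (real ^ 'n \<Rightarrow> real ^ 'n ^ 'n) \<Rightarrow> (real \<Rightarrow> real ^ 'n) \<Rightarrow> real \<Rightarrow> real \<Rightarrow> bool" where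
  "admissible_curve M g \<gamma> a b \<longleftrightarrow>
     a \<le> b \<and> \<gamma> piecewise_C1_differentiable_on {a..b} \<and> \<gamma> ` {a..b} \<subseteq> M \<and> speed g \<gamma> integrable_on {a..b}"

definition curve_lengths ::
  "(real ^ 'n) set \<Rightarrow> (real ^ 'n \<Rightarrow> real ^ 'n ^ 'n) \<Rightarrow> real ^ 'n \<Rightarrow> real ^ 'n \<Rightarrow> real set" where
  "curve_lengths M g P Q = {arc_length g \<gamma> a b | \<gamma> a b. admissible_curve M g \<gamma> a b \<and> \<gamma> a = P \<and> \<gamma> b = Q}"

definition riemannian_distance ::
  "(real ^ 'n) set \<Rightarrow> (real ^ 'n \<Rightarrow> real ^ 'n ^ 'n) \<Rightarrow> real ^ 'n \<Rightarrow> real ^ 'n \<Rightarrow> real" where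
  "riemannian_distance M g P Q = Inf (curve_lengths M g P Q)"

definition geodesic ::
  "(real ^ 'n) set \<Rightarrow> (real ^ 'n \<Rightarrow> real ^ 'n ^ 'n) \<Rightarrow> (real \<Rightarrow> real ^ 'n) \<Rightarrow> real \<Rightarrow> real \<Rightarrow> bool" where
  "geodesic M g \<gamma> a b \<longleftrightarrow>
     admissible_curve M g \<gamma> a b \<and> (\<forall>L\<in>curve_lengths M g (\<gamma> a) (\<gamma> b). arc_length g \<gamma> a b \<le> L)"

lemma riemannian_distance_eq_geodesic_length:
  assumes "geodesic M g \<gamma> a b"
  shows "riemannian_distance M g (\<gamma> a) (\<gamma> b) = arc_length g \<gamma> a b"
  unfolding riemannian_distance_def
proof (rule cInf_eq_minimum)
  show "arc_length g \<gamma> a b \<in> curve_lengths M g (\<gamma> a) (\<gamma> b)"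
    using assms unfolding geodesic_def curve_lengths_def by blast
qed (use assms in \<open>auto simp: geodesic_def\<close>)

definition unitary_parametrization ::
  "(real ^ 'n \<Rightarrow> real ^ 'n ^ 'n) \<Rightarrow> (real \<Rightarrow> real ^ 'n) \<Rightarrow> real \<Rightarrow> real \<Rightarrow> bool" where
  "unitary_parametrization g \<gamma> a b \<longleftrightarrow>
     \<gamma> C1_differentiable_on {a..b} \<and>
     (\<forall>t\<in>{a..b}. metric_form g (\<gamma> t) (vector_derivative \<gamma> (at t)) (vector_derivative \<gamma> (at t)) = 1)"

definition dissipation :: "(real ^ 'n \<Rightarrow> real) \<Rightarrow> (real \<Rightarrow> real ^ 'n) \<Rightarrow> real \<Rightarrow> real" where
  "dissipation S \<gamma> t = deriv (\<lambda>s. S (\<gamma> s)) t"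

definition distribution_of :: "(real ^ 'n) set \<Rightarrow> (real ^ 'n \<Rightarrow> real) \<Rightarrow> (real ^ 'n) measure" where
  "distribution_of M \<rho> = density (restrict_space lborel M) (\<lambda>x. ennreal (\<rho> x))"

text \<open>Tending to the boundary, points at infinity included, means leaving every compact subset.\<close>

definition vanishes_at_boundary :: "(real ^ 'n) set \<Rightarrow> (real ^ 'n \<Rightarrow> real) \<Rightarrow> bool" where
  "vanishes_at_boundary M f \<longleftrightarrow> (\<forall>e>0. \<exists>K. compact K \<and> K \<subseteq> M \<and> (\<forall>x\<in>M - K. \<bar>f x\<bar> < e))"

locale fluctuation_geometry =
  fixes M :: "(real ^ 'n) set"
    and g :: "real ^ 'n \<Rightarrow> real ^ 'n ^ 'n"
    and \<Gamma> :: "'n \<Rightarrow> 'n \<Rightarrow> 'n \<Rightarrow> real ^ 'n \<Rightarrow> real"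
    and \<rho> :: "real ^ 'n \<Rightarrow> real"
    and S :: "real ^ 'n \<Rightarrow> real"
  assumes domain: "open M" "M \<noteq> {}" "simply_connected M"
    and density_smooth: "smooth_fun_on M \<rho>"
    and density_nonneg: "\<And>x. x \<in> M \<Longrightarrow> \<rho> x \<ge> 0"
    and prob: "prob_space (distribution_of M \<rho>)"
    and metric: "riemannian_metric_on M g"
    and connection: "levi_civita_on M g \<Gamma>"
    and potential_smooth: "smooth_fun_on M S"
    and potential: "distribution_of M \<rho> = density (invariant_volume M g) (\<lambda>x. ennreal (exp (S x)))"
    and dissipation: "\<And>\<gamma> a b t1 t2. geodesic M g \<gamma> a b \<Longrightarrow> unitary_parametrization g \<gamma> a b \<Longrightarrow>
          a \<le> t1 \<Longrightarrow> t1 < t2 \<Longrightarrow> t2 \<le> b \<Longrightarrow>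
          arc_length g \<gamma> t1 t2 = dissipation S \<gamma> t1 - dissipation S \<gamma> t2"
    and boundary_density: "\<not> compact M \<Longrightarrow> vanishes_at_boundary M \<rho>"
    and boundary_density_deriv: "\<And>i. \<not> compact M \<Longrightarrow> vanishes_at_boundary M (partial_deriv i \<rho>)"
    and boundary_weight: "\<not> compact M \<Longrightarrow> vanishes_at_boundary M (\<lambda>x. exp (S x))"

definition stationary_point :: "(real ^ 'n \<Rightarrow> real) \<Rightarrow> real ^ 'n \<Rightarrow> bool" where
  "stationary_point S x \<longleftrightarrow> (\<forall>i. partial_deriv i S x = 0)"

definition max_potential_point :: "(real ^ 'n) set \<Rightarrow> (real ^ 'n \<Rightarrow> real) \<Rightarrow> real ^ 'n \<Rightarrow> bool" where
  "max_potential_point M S p \<longleftrightarrow>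
     p \<in> M \<and> stationary_point S p \<and> (\<forall>x\<in>M. stationary_point S x \<longrightarrow> x = p) \<and> (\<forall>x\<in>M. S x \<le> S p)"

definition psi :: "(real ^ 'n \<Rightarrow> real) \<Rightarrow> real ^ 'n \<Rightarrow> real ^ 'n" where
  "psi S x = (\<chi> i. - partial_deriv i S x)"

definition psi_squared :: "(real ^ 'n \<Rightarrow> real ^ 'n ^ 'n) \<Rightarrow> (real ^ 'n \<Rightarrow> real) \<Rightarrow> real ^ 'n \<Rightarrow> real" where
  "psi_squared g S x = psi S x \<bullet> (matrix_inv (g x) *v psi S x)"

definition gaussian_potential ::
  "(real ^ 'n) set \<Rightarrow> (real ^ 'n \<Rightarrow> real ^ 'n ^ 'n) \<Rightarrow> (real ^ 'n \<Rightarrow> real) \<Rightarrow> real" where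
  "gaussian_potential M g S = (THE c. \<forall>x\<in>M. S x + 1 / 2 * psi_squared g S x = c)"

text \<open>The solution \<open>Z > 0\<close> of \<open>gaussian_potential M g S = - ln Z\<close>.\<close>

definition gaussian_partition ::
  "(real ^ 'n) set \<Rightarrow> (real ^ 'n \<Rightarrow> real ^ 'n ^ 'n) \<Rightarrow> (real ^ 'n \<Rightarrow> real) \<Rightarrow> real" where
  "gaussian_partition M g S = exp (- gaussian_potential M g S)"

end

theory Submission
  imports Defs
begin

text \<open>
  Axiom 3 says that \<open>S\<close> has second derivative $-1$ along shortest unit-speed curves. Through every point and in
  every direction there is a short one: the geodesic equation is solved by the Picard--Lindeloef theorem, and a
  calibration shows that short solutions are shortest. Polarisation then gives $D_i D_j S = - g_{ij}$. Hence the
  gradient field satisfies $D_k \psi^i = \delta^i_k$, so that $S + \frac12 \psi^2$ is constant, with value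
  $S(\bar I)$, and $r = \sqrt{2 (S(\bar I) - S)}$ has gradient of length 1 away from $\bar I$.
  Therefore $r \le \ell$. Conversely the sets $\{S \ge S(x)\}$ are compact by Axiom 4, so
  $r + \theta\,\mathfrak{D}(x, \cdot)$ with $\theta < 1$ attains a minimum there; it can only be attained at $\bar I$,
  since a small step along the gradient decreases the functional. This gives $\theta \ell \le r$ without any
  completeness assumption. Finally $S = \mathcal{P} - \frac12 \ell^2$, and the constant is fixed by normalisation.
\<close>

section \<open>Local solutions of ordinary differential equations\<close>

text \<open>The direct route would integrate Axiom 3 along a shortest curve from a point to
  \<open>Ibar\<close>, but in a domain that may be incomplete such a curve cannot be taken for
  granted. So Axiom 3 is used only infinitesimally, on short curves, and the distance is handled as
  an infimum throughout. The axiom speaks of curves that are shortest among all curves of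
  \<open>M\<close>; hence a short solution of the geodesic equation also has to beat competitors
  that leave the ball on which the metric is controlled. Those are treated separately, by the length
  it takes to get out of the ball. For the others, normal coordinates and the Gauss lemma would call
  for smooth dependence of solutions on their initial values; an explicit quadratic calibration
  around one single solution asks only for that solution. Competitors may have finitely many
  corners, near which the velocity may be unbounded, so the lower bounds for lengths go through one
  fundamental theorem of calculus with exceptional points.\<close>

lemma picard_lindeloef_autonomous:
  fixes f :: "'a::euclidean_space \<Rightarrow> 'a"
  assumes lip: "L-lipschitz_on (cball z0 r) f" and r: "r > 0"
  obtains \<delta> z where "\<delta> > 0" "z 0 = z0" "\<And>t. \<bar>t\<bar> < \<delta> \<Longrightarrow> z t \<in> cball z0 r"
    "\<And>t. \<bar>t\<bar> < \<delta> \<Longrightarrow> (z has_vector_derivative f (z t)) (at t)"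
proof -
  \<comment> \<open>Composition with the nearest-point map, which is 1-Lipschitz, makes the field
    bounded and Lipschitz on the whole space, so that the fixed point can be sought among all
    bounded continuous functions. The fixed point stays in the ball, where this map is the
    identity.\<close>
  define \<pi> where "\<pi> = closest_point (cball z0 r)"
  define F where "F y = f (\<pi> y)" for y
  have \<pi>_in: "\<pi> y \<in> cball z0 r" for y
    unfolding \<pi>_def using r by (intro closest_point_in_set) auto
  have L0: "L \<ge> 0" using lip by (rule lipschitz_on_nonneg)
  have F_lip: "norm (F x - F y) \<le> L * dist x y" for x y
  proof -
    have "dist (f (\<pi> x)) (f (\<pi> y)) \<le> L * dist (\<pi> x) (\<pi> y)"
      using lip \<pi>_in by (rule lipschitz_onD) (rule \<pi>_in)
    also have "\<dots> \<le> L * dist x y"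
      unfolding \<pi>_def using r L0 by (intro mult_left_mono closest_point_lipschitz) auto
    finally show ?thesis by (simp add: F_def dist_norm)
  qed
  have "L-lipschitz_on UNIV F"
    using F_lip L0 by (intro lipschitz_onI) (auto simp: dist_norm)
  then have F_cont: "continuous_on UNIV F" by (rule lipschitz_on_continuous_on)
  have "compact (f ` cball z0 r)"
    using lip by (intro compact_continuous_image lipschitz_on_continuous_on) auto
  then obtain B where B: "B > 0" "\<And>y. y \<in> cball z0 r \<Longrightarrow> norm (f y) \<le> B"
    using compact_imp_bounded bounded_pos by (metis imageI)
  have F_bd: "norm (F y) \<le> B" for y unfolding F_def using B \<pi>_in by blast
  \<comment> \<open>\<open>T\<close> contains two integrals over intervals of length at most
    \<open>2 * \<delta>\<close>. The first quotient bounds the displacement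
    \<open>4 * \<delta> * B\<close> by \<open>r\<close>, the second makes the contraction factor
    \<open>4 * \<delta> * L\<close> at most 1/2.\<close>
  define \<delta> where "\<delta> = min (r / (4 * B)) (1 / (8 * (L + 1)))"
  have \<delta>: "\<delta> > 0" "4 * \<delta> * B \<le> r" "4 * \<delta> * L \<le> 1 / 2"
  proof -
    show "\<delta> > 0" using r B L0 by (auto simp: \<delta>_def)
    have "\<delta> \<le> r / (4 * B)" by (simp add: \<delta>_def)
    then show "4 * \<delta> * B \<le> r" using B by (simp add: field_simps)
    have "\<delta> \<le> 1 / (8 * (L + 1))" by (simp add: \<delta>_def)
    then have "8 * \<delta> * (L + 1) \<le> 1" using L0 by (simp add: field_simps)
    then show "4 * \<delta> * L \<le> 1 / 2" using \<open>\<delta> > 0\<close> by (simp add: algebra_simps)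
  qed
  \<comment> \<open>Freezing time outside the interval turns the iterates into functions on the
    whole real line, as the type of bounded continuous functions requires.\<close>
  define c where "c t = max (- \<delta>) (min \<delta> t)" for t :: real
  have c: "- \<delta> \<le> c t" "c t \<le> \<delta>" for t using \<delta> by (auto simp: c_def)
  have c_id: "c t = t" if "\<bar>t\<bar> \<le> \<delta>" for t using that by (auto simp: c_def)
  define J where "J x t = integral {-\<delta>..t} (\<lambda>s. F (x s))" for x :: "real \<Rightarrow> 'a" and t
  have Fx: "continuous_on A (\<lambda>s. F (x s))" if "continuous_on UNIV x" for x A
    by (rule continuous_on_compose2[OF F_cont continuous_on_subset[OF that]]) auto
  have Fint: "(\<lambda>s. F (x s)) integrable_on {u..v}" if "continuous_on UNIV x" for x :: "real \<Rightarrow> 'a" and u v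
    using Fx[OF that] by (rule integrable_continuous_real)
  have J_bd: "norm (J x t) \<le> 2 * \<delta> * B" if "continuous_on UNIV x" "-\<delta> \<le> t" "t \<le> \<delta>" for x t
  proof -
    have "norm (J x t) \<le> B * (t - - \<delta>)"
      unfolding J_def using that F_bd Fx by (intro integral_bound) auto
    also have "\<dots> \<le> B * (2 * \<delta>)" using that B by (intro mult_left_mono) auto
    finally show ?thesis by (simp add: algebra_simps)
  qed
  \<comment> \<open>The integrals start at \<open>-\<delta>\<close>; subtracting
    \<open>J x 0\<close> gives the oriented integral from 0 for times of either sign.\<close>
  define T where "T x t = z0 + J x (c t) - J x 0" for x t
  have T_near: "norm (T x t - z0) \<le> r" if "continuous_on UNIV x" for x t
  proof -
    have "norm (J x (c t) - J x 0) \<le> norm (J x (c t)) + norm (J x 0)" by (rule norm_triangle_ineq4)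
    also have "\<dots> \<le> 2 * \<delta> * B + 2 * \<delta> * B"
      using that c \<delta>(1) by (intro add_mono J_bd) auto
    finally show ?thesis using \<delta>(2) by (simp add: T_def algebra_simps)
  qed
  have T_bcont: "T x \<in> bcontfun" if x: "continuous_on UNIV x" for x
  proof (rule bcontfun_normI)
    have "continuous_on {-\<delta>..\<delta>} (J x)"
      unfolding J_def by (rule indefinite_integral_continuous_1) (rule Fint[OF x])
    then have "continuous_on UNIV (\<lambda>t. J x (c t))"
      by (rule continuous_on_compose2) (use \<delta>(1) in \<open>auto simp: c_def intro!: continuous_intros\<close>)
    then show "continuous_on UNIV (T x)" unfolding T_def by (intro continuous_intros)
    show "norm (T x t) \<le> norm z0 + r" for t
      using T_near[OF x, of t] norm_triangle_ineq2[of "T x t" z0] by linarith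
  qed
  define TT where "TT x = Bcontfun (T (apply_bcontfun x))" for x :: "real \<Rightarrow>\<^sub>C 'a"
  have TT: "apply_bcontfun (TT x) t = T (apply_bcontfun x) t" for x t
    unfolding TT_def by (subst Bcontfun_inverse) (auto intro: T_bcont)
  have contr: "dist (TT x) (TT y) \<le> 1 / 2 * dist x y" for x y
  proof (rule dist_bound)
    fix t
    have *: "norm (J x s - J y s) \<le> 2 * \<delta> * L * dist x y" if "-\<delta> \<le> s" "s \<le> \<delta>" for s
    proof -
      have "J x s - J y s = integral {-\<delta>..s} (\<lambda>t. F (x t) - F (y t))"
        unfolding J_def by (intro Henstock_Kurzweil_Integration.integral_diff[symmetric] Fint) auto
      moreover have "norm (F (x t) - F (y t)) \<le> L * dist x y" for t
        using F_lip[of "x t" "y t"] mult_left_mono[OF dist_bounded L0] by (meson order_trans)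
      ultimately have "norm (J x s - J y s) \<le> L * dist x y * (s - - \<delta>)"
        using that integral_bound[of "-\<delta>" s "\<lambda>t. F (x t) - F (y t)" "L * dist x y"]
          continuous_on_diff[OF Fx Fx, of x y "{-\<delta>..s}"] by auto
      also have "\<dots> \<le> L * dist x y * (2 * \<delta>)" using that L0 by (intro mult_left_mono) auto
      finally show ?thesis by (simp add: algebra_simps)
    qed
    have "dist (TT x t) (TT y t) = norm ((J x (c t) - J y (c t)) - (J x 0 - J y 0))"
      by (simp add: TT T_def dist_norm algebra_simps)
    also have "\<dots> \<le> norm (J x (c t) - J y (c t)) + norm (J x 0 - J y 0)" by (rule norm_triangle_ineq4)
    also have "\<dots> \<le> 2 * \<delta> * L * dist x y + 2 * \<delta> * L * dist x y"
      using c \<delta>(1) by (intro add_mono *) auto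
    also have "\<dots> = 4 * \<delta> * L * dist x y" by simp
    also have "\<dots> \<le> 1 / 2 * dist x y" using \<delta> by (intro mult_right_mono) auto
    finally show "dist (TT x t) (TT y t) \<le> 1 / 2 * dist x y" .
  qed
  obtain z where "TT z = z" using banach_fix_type[of "1/2" TT] contr by auto
  then have z: "apply_bcontfun z t = T z t" for t using TT[of z t] by simp
  have near: "apply_bcontfun z t \<in> cball z0 r" for t
    using T_near[of z t, OF continuous_on_apply_bcontfun] by (simp add: z dist_norm norm_minus_commute)
  show thesis
  proof
    show "\<delta> > 0" by fact
    show "apply_bcontfun z 0 = z0" using z[of 0] \<delta> by (simp add: T_def c_id)
    show "apply_bcontfun z t \<in> cball z0 r" for t by (rule near)
    fix t assume t: "\<bar>t\<bar> < \<delta>"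
    have Fz: "F (z s) = f (z s)" for s
      by (simp add: F_def \<pi>_def closest_point_self[OF near])
    have "(J z has_vector_derivative F (z t)) (at t within {-\<delta>..\<delta>})"
      unfolding J_def using t by (intro integral_has_vector_derivative Fx) auto
    then have J': "(J z has_vector_derivative F (z t)) (at t)"
      using t by (subst (asm) at_within_interior) auto
    have "((\<lambda>s. z0 + J z s - J z 0) has_vector_derivative F (z t)) (at t)"
      using J' by (auto intro!: derivative_eq_intros)
    then have "(apply_bcontfun z has_vector_derivative F (z t)) (at t)"
    proof (rule has_vector_derivative_transform_within_open[where S="{-\<delta><..<\<delta>}"])
      show "z0 + J z s - J z 0 = z s" if "s \<in> {-\<delta><..<\<delta>}" for s
      proof -
        have "c s = s" using that by (intro c_id) auto
        then show ?thesis by (subst z) (simp add: T_def)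
      qed
    qed (use t in auto)
    then show "(apply_bcontfun z has_vector_derivative f (z t)) (at t)" by (simp add: Fz)
  qed
qed

section \<open>Gradients and Hessians of smooth functions\<close>

definition grad :: "(real ^ 'n \<Rightarrow> real) \<Rightarrow> real ^ 'n \<Rightarrow> real ^ 'n" where
  "grad f x = (\<chi> i. partial_deriv i f x)"

text \<open>\<open>h\<close> is the direction of differentiation and \<open>k\<close> the vector
  paired with the gradient; symmetry is a theorem, \<open>hess_sym\<close>.\<close>

definition hess :: "(real ^ 'n \<Rightarrow> real) \<Rightarrow> real ^ 'n \<Rightarrow> real ^ 'n \<Rightarrow> real ^ 'n \<Rightarrow> real" where
  "hess f x h k = (\<Sum>i\<in>UNIV. k $ i * (grad (partial_deriv i f) x \<bullet> h))"

lemma smooth_fun_on_continuous: "smooth_fun_on M f \<Longrightarrow> continuous_on M f"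
  unfolding smooth_fun_on_def by (drule spec[of _ 0]) simp

lemma smooth_fun_on_partial: "smooth_fun_on M f \<Longrightarrow> smooth_fun_on M (partial_deriv i f)"
  unfolding smooth_fun_on_def by (metis Ck_on.simps(2))

lemma smooth_has_derivative_grad:
  assumes "smooth_fun_on M f" "open M" "x \<in> M"
  shows "(f has_derivative (\<lambda>h. grad f x \<bullet> h)) (at x within T)"
proof -
  have "f differentiable_on M" using assms(1) unfolding smooth_fun_on_def by (metis Ck_on.simps(2))
  then have "f differentiable at x"
    using assms differentiable_on_eq_differentiable_at by blast
  then have D: "(f has_derivative frechet_derivative f (at x)) (at x)"
    using frechet_derivative_works by blast
  then interpret bounded_linear "frechet_derivative f (at x)" by (rule has_derivative_bounded_linear)
  have "frechet_derivative f (at x) h = grad f x \<bullet> h" for h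
  proof -
    have "frechet_derivative f (at x) h = frechet_derivative f (at x) (\<Sum>i\<in>UNIV. h $ i *\<^sub>R axis i 1)"
      using basis_expansion[of h] by (simp add: scalar_mult_eq_scaleR)
    also have "\<dots> = grad f x \<bullet> h"
      by (simp add: sum scaleR grad_def partial_deriv_def inner_vec_def mult.commute)
    finally show ?thesis .
  qed
  then have "frechet_derivative f (at x) = (\<lambda>h. grad f x \<bullet> h)" by auto
  with D show ?thesis by (simp add: has_derivative_at_withinI)
qed

lemma smooth_compose_has_vector_derivative:
  assumes "smooth_fun_on M f" "open M" "\<gamma> t \<in> M" "(\<gamma> has_vector_derivative v) (at t within T)"
  shows "((\<lambda>s. f (\<gamma> s)) has_real_derivative grad f (\<gamma> t) \<bullet> v) (at t within T)"
proof -
  have "((\<lambda>s. f (\<gamma> s)) has_derivative (\<lambda>s. grad f (\<gamma> t) \<bullet> (s *\<^sub>R v))) (at t within T)"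
    by (rule has_derivative_compose[OF assms(4)[unfolded has_vector_derivative_def]
          smooth_has_derivative_grad[OF assms(1-3), of UNIV]])
  then show ?thesis unfolding has_field_derivative_def
    by (rule has_derivative_eq_rhs) (simp add: mult.commute fun_eq_iff)
qed

lemma smooth_continuous_on_grad:
  assumes "smooth_fun_on M f"
  shows "continuous_on M (grad f)"
  unfolding grad_def
  by (intro continuous_on_vec_lambda smooth_fun_on_continuous smooth_fun_on_partial assms)

lemma smooth_bounded:
  assumes "smooth_fun_on M f" "compact K" "K \<subseteq> M"
  obtains C where "C > 0" "\<And>x. x \<in> K \<Longrightarrow> \<bar>f x\<bar> \<le> C"
proof -
  have "bounded (f ` K)"
    using assms by (meson compact_continuous_image compact_imp_bounded continuous_on_subset smooth_fun_on_continuous)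
  then show thesis using that unfolding bounded_pos by auto
qed

lemma smooth_lipschitz:
  assumes "smooth_fun_on M f" "open M" "compact K" "convex K" "K \<subseteq> M"
  obtains C where "C > 0" "\<And>x y. x \<in> K \<Longrightarrow> y \<in> K \<Longrightarrow> \<bar>f y - f x\<bar> \<le> C * norm (y - x)"
proof -
  have "bounded (grad f ` K)"
    using assms by (meson compact_continuous_image compact_imp_bounded continuous_on_subset smooth_continuous_on_grad)
  then obtain C where C: "C > 0" "\<And>x. x \<in> K \<Longrightarrow> norm (grad f x) \<le> C"
    unfolding bounded_pos by auto
  have "\<bar>f y - f x\<bar> \<le> C * norm (y - x)" if "x \<in> K" "y \<in> K" for x y
  proof -
    have "norm (f y - f x) \<le> C * norm (y - x)"
    proof (rule differentiable_bound[OF \<open>convex K\<close>])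
      show "(f has_derivative (\<lambda>h. grad f z \<bullet> h)) (at z within K)" if "z \<in> K" for z
        using smooth_has_derivative_grad assms that by blast
      show "onorm (\<lambda>h. grad f z \<bullet> h) \<le> C" if "z \<in> K" for z
      proof (rule onorm_le)
        show "norm (grad f z \<bullet> h) \<le> C * norm h" for h
          using Cauchy_Schwarz_ineq2[of "grad f z" h] mult_right_mono[OF C(2)[OF that], of "norm h"]
          by simp
      qed
    qed (use that in auto)
    then show ?thesis by simp
  qed
  with C show thesis using that by blast
qed

lemma smooth_grad_lipschitz:
  assumes "smooth_fun_on M f" "open M" "compact K" "convex K" "K \<subseteq> M"
  obtains C where "C > 0" "\<And>x y. x \<in> K \<Longrightarrow> y \<in> K \<Longrightarrow> norm (grad f y - grad f x) \<le> C * norm (y - x)"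
proof -
  have "\<exists>C>0. \<forall>x\<in>K. \<forall>y\<in>K. \<bar>partial_deriv i f y - partial_deriv i f x\<bar> \<le> C * norm (y - x)" for i
    using smooth_lipschitz[OF smooth_fun_on_partial[OF assms(1)] assms(2-5)] by metis
  then obtain C where C: "\<And>i. C i > 0"
    "\<And>i x y. x \<in> K \<Longrightarrow> y \<in> K \<Longrightarrow> \<bar>partial_deriv i f y - partial_deriv i f x\<bar> \<le> C i * norm (y - x)"
    by metis
  have "norm (grad f y - grad f x) \<le> (\<Sum>i\<in>UNIV. C i) * norm (y - x)" if "x \<in> K" "y \<in> K" for x y
  proof -
    have "norm (grad f y - grad f x) \<le> (\<Sum>i\<in>UNIV. \<bar>(grad f y - grad f x) $ i\<bar>)"
      by (rule norm_le_l1_cart)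
    also have "\<dots> \<le> (\<Sum>i\<in>UNIV. C i * norm (y - x))"
      by (intro sum_mono) (use C(2)[OF that] in \<open>simp add: grad_def\<close>)
    finally show ?thesis by (simp add: sum_distrib_right)
  qed
  moreover have "(\<Sum>i\<in>UNIV. C i) > 0" using C(1) by (intro sum_pos) auto
  ultimately show thesis using that by blast
qed

lemma smooth_taylor2:
  assumes "smooth_fun_on M f" "open M" "compact K" "convex K" "K \<subseteq> M"
  obtains C where "C > 0"
    "\<And>x y. x \<in> K \<Longrightarrow> y \<in> K \<Longrightarrow> \<bar>f y - f x - grad f x \<bullet> (y - x)\<bar> \<le> C * (norm (y - x))\<^sup>2"
proof -
  obtain C where C: "C > 0" "\<And>x y. x \<in> K \<Longrightarrow> y \<in> K \<Longrightarrow> norm (grad f y - grad f x) \<le> C * norm (y - x)"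
    using smooth_grad_lipschitz[OF assms] by blast
  have "\<bar>f y - f x - grad f x \<bullet> (y - x)\<bar> \<le> C * (norm (y - x))\<^sup>2" if xy: "x \<in> K" "y \<in> K" for x y
  proof -
    have seg: "closed_segment x y \<subseteq> K" using assms(4) xy by (simp add: closed_segment_subset)
    have "norm (f y - f x - grad f x \<bullet> (y - x)) \<le> norm (y - x) * (C * norm (y - x))"
    proof (rule differentiable_bound_linearization[where S = "closed_segment x y" and f' = "\<lambda>z h. grad f z \<bullet> h" and ?x0.0 = x])
      show "x + t *\<^sub>R (y - x) \<in> closed_segment x y" if "t \<in> {0..1}" for t
        using that by (auto simp: closed_segment_def algebra_simps intro!: exI[of _ t])
      show "(f has_derivative (\<lambda>h. grad f z \<bullet> h)) (at z within closed_segment x y)"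
        if "z \<in> closed_segment x y" for z
        using smooth_has_derivative_grad assms seg that by blast
      show "onorm ((\<lambda>h. grad f z \<bullet> h) - (\<lambda>h. grad f x \<bullet> h)) \<le> C * norm (y - x)"
        if z: "z \<in> closed_segment x y" for z
      proof (rule onorm_le)
        fix h
        have "norm (((\<lambda>h. grad f z \<bullet> h) - (\<lambda>h. grad f x \<bullet> h)) h) = \<bar>(grad f z - grad f x) \<bullet> h\<bar>"
          by (simp add: inner_diff_left)
        also have "\<dots> \<le> norm (grad f z - grad f x) * norm h" by (rule Cauchy_Schwarz_ineq2)
        also have "\<dots> \<le> C * norm (y - x) * norm h"
        proof (rule mult_right_mono)
          have "norm (grad f z - grad f x) \<le> C * norm (z - x)" using C z seg xy by blast
          also have "\<dots> \<le> C * norm (y - x)"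
            using segment_bound1[OF z] C(1) by (intro mult_left_mono) (auto simp: norm_minus_commute)
          finally show "norm (grad f z - grad f x) \<le> C * norm (y - x)" .
        qed auto
        finally show "norm (((\<lambda>h. grad f z \<bullet> h) - (\<lambda>h. grad f x \<bullet> h)) h) \<le> C * norm (y - x) * norm h" .
      qed
    qed auto
    then show ?thesis by (simp add: power2_eq_square algebra_simps)
  qed
  with C(1) show thesis using that by blast
qed

lemma smooth_lipschitz_taylor2:
  assumes "smooth_fun_on M f" "open M" "compact K" "convex K" "K \<subseteq> M"
  obtains C where "C > 0"
    "\<And>x y. x \<in> K \<Longrightarrow> y \<in> K \<Longrightarrow> \<bar>f y - f x\<bar> \<le> C * norm (y - x)"
    "\<And>x y. x \<in> K \<Longrightarrow> y \<in> K \<Longrightarrow> \<bar>f y - f x - grad f x \<bullet> (y - x)\<bar> \<le> C * (norm (y - x))\<^sup>2"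
proof -
  obtain C1 C2 where C: "C1 > 0" "C2 > 0"
    "\<And>x y. x \<in> K \<Longrightarrow> y \<in> K \<Longrightarrow> \<bar>f y - f x\<bar> \<le> C1 * norm (y - x)"
    "\<And>x y. x \<in> K \<Longrightarrow> y \<in> K \<Longrightarrow> \<bar>f y - f x - grad f x \<bullet> (y - x)\<bar> \<le> C2 * (norm (y - x))\<^sup>2"
    using smooth_lipschitz[OF assms] smooth_taylor2[OF assms] by metis
  show thesis
  proof
    show "max C1 C2 > 0" using C by auto
    show "\<bar>f y - f x\<bar> \<le> max C1 C2 * norm (y - x)" if "x \<in> K" "y \<in> K" for x y
      using C(3)[OF that] by (rule order_trans) (intro mult_right_mono, auto)
    show "\<bar>f y - f x - grad f x \<bullet> (y - x)\<bar> \<le> max C1 C2 * (norm (y - x))\<^sup>2" if "x \<in> K" "y \<in> K" for x y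
      using C(4)[OF that] by (rule order_trans) (intro mult_right_mono, auto)
  qed
qed

section \<open>Second derivatives and their symmetry\<close>

lemma hess_add_left: "hess f x (h + h') k = hess f x h k + hess f x h' k"
  by (simp add: hess_def inner_add_right algebra_simps sum.distrib)
lemma hess_add_right: "hess f x h (k + k') = hess f x h k + hess f x h k'"
  by (simp add: hess_def algebra_simps sum.distrib)
lemma hess_scaleR_left: "hess f x (c *\<^sub>R h) k = c * hess f x h k"
  by (simp add: hess_def algebra_simps sum_distrib_left)
lemma hess_scaleR_right: "hess f x h (c *\<^sub>R k) = c * hess f x h k"
  by (simp add: hess_def algebra_simps sum_distrib_left)

lemma smooth_hess_estimate:
  assumes "smooth_fun_on M f" "open M" "compact K" "convex K" "K \<subseteq> M"
  obtains C where "C > 0"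
    "\<And>x y k. x \<in> K \<Longrightarrow> y \<in> K \<Longrightarrow> 
       \<bar>grad f y \<bullet> k - grad f x \<bullet> k - hess f x (y - x) k\<bar> \<le> C * (norm (y - x))\<^sup>2 * norm k"
proof -
  have "\<exists>C>0. \<forall>x\<in>K. \<forall>y\<in>K. 
      \<bar>partial_deriv i f y - partial_deriv i f x - grad (partial_deriv i f) x \<bullet> (y - x)\<bar> \<le> C * (norm (y - x))\<^sup>2" for i
    using smooth_taylor2[OF smooth_fun_on_partial[OF assms(1)] assms(2-5)] by metis
  then obtain C where C: "\<And>i. C i > 0"
    "\<And>i x y. x \<in> K \<Longrightarrow> y \<in> K \<Longrightarrow> 
     \<bar>partial_deriv i f y - partial_deriv i f x - grad (partial_deriv i f) x \<bullet> (y - x)\<bar> \<le> C i * (norm (y - x))\<^sup>2"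
    by metis
  have "\<bar>grad f y \<bullet> k - grad f x \<bullet> k - hess f x (y - x) k\<bar> \<le> (\<Sum>i\<in>UNIV. C i) * (norm (y - x))\<^sup>2 * norm k"
    if "x \<in> K" "y \<in> K" for x y k
  proof -
    let ?r = "\<lambda>i. partial_deriv i f y - partial_deriv i f x - grad (partial_deriv i f) x \<bullet> (y - x)"
    have eq: "grad f y \<bullet> k - grad f x \<bullet> k - hess f x (y - x) k = (\<Sum>i\<in>UNIV. ?r i * k $ i)"
      by (simp only: left_diff_distrib hess_def grad_def inner_vec_def sum_subtractf inner_real_def
          vec_lambda_beta mult.commute right_diff_distrib)
    have "\<bar>\<Sum>i\<in>UNIV. ?r i * k $ i\<bar> \<le> (\<Sum>i\<in>UNIV. \<bar>?r i * k $ i\<bar>)" by (rule sum_abs)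
    also have "\<dots> \<le> (\<Sum>i\<in>UNIV. C i * (norm (y - x))\<^sup>2 * norm k)"
    proof (rule sum_mono)
      fix i
      have "\<bar>?r i\<bar> * \<bar>k $ i\<bar> \<le> (C i * (norm (y - x))\<^sup>2) * norm k"
        using C(2)[OF that, of i] C(1)[of i] component_le_norm_cart[of k i] by (intro mult_mono) auto
      then show "\<bar>?r i * k $ i\<bar> \<le> C i * (norm (y - x))\<^sup>2 * norm k" by (simp add: abs_mult)
    qed
    finally show ?thesis unfolding eq sum_distrib_right .
  qed
  moreover have "(\<Sum>i\<in>UNIV. C i) > 0" using C(1) by (intro sum_pos) auto
  ultimately show thesis using that by blast
qed

text \<open>The mean value theorem is applied to the increment of \<open>f\<close> between two
  parallel segments in direction \<open>h\<close> that are \<open>t *\<^sub>R k\<close> apart.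
  Linearising the gradient at \<open>x\<close> leaves \<open>t * hess f x k h\<close>, because the
  contributions of the intermediate parameter \<open>\<xi>\<close> cancel.\<close>

lemma second_difference_estimate:
  assumes f: "smooth_fun_on M f" "open M" and R: "cball x R \<subseteq> M" and t: "t > 0" "t * (norm h + norm k) \<le> R"
    and C: "C > 0" "\<And>y k. y \<in> cball x R \<Longrightarrow>
       \<bar>grad f y \<bullet> k - grad f x \<bullet> k - hess f x (y - x) k\<bar> \<le> C * (norm (y - x))\<^sup>2 * norm k"
  shows "\<bar>f (x + t *\<^sub>R h + t *\<^sub>R k) - f (x + t *\<^sub>R h) - f (x + t *\<^sub>R k) + f x - t\<^sup>2 * hess f x k h\<bar>
           \<le> t ^ 3 * (2 * C * (norm h + norm k)\<^sup>2 * norm h)"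
proof -
  define \<phi> where "\<phi> s = f (x + t *\<^sub>R k + s *\<^sub>R h) - f (x + s *\<^sub>R h)" for s
  define \<phi>' where "\<phi>' s = grad f (x + t *\<^sub>R k + s *\<^sub>R h) \<bullet> h - grad f (x + s *\<^sub>R h) \<bullet> h" for s
  have bd: "norm (s *\<^sub>R h) \<le> t * (norm h + norm k)"
    "norm (t *\<^sub>R k + s *\<^sub>R h) \<le> t * (norm h + norm k)" if "0 \<le> s" "s \<le> t" for s
  proof -
    have *: "s * norm h \<le> t * norm h" "0 \<le> t * norm k" "\<bar>s\<bar> = s" using that by (auto intro: mult_right_mono)
    then show "norm (s *\<^sub>R h) \<le> t * (norm h + norm k)" using that unfolding distrib_left norm_scaleR by linarith
    show "norm (t *\<^sub>R k + s *\<^sub>R h) \<le> t * (norm h + norm k)" 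
      using norm_triangle_ineq[of "t *\<^sub>R k" "s *\<^sub>R h"] that * by (simp add: distrib_left)
  qed
  have inR: "x + s *\<^sub>R h \<in> cball x R" "x + t *\<^sub>R k + s *\<^sub>R h \<in> cball x R" if "0 \<le> s" "s \<le> t" for s
  proof -
    show "x + s *\<^sub>R h \<in> cball x R" using bd(1)[OF that] t(2) by (simp add: dist_norm)
    have "norm (x - (x + t *\<^sub>R k + s *\<^sub>R h)) = norm (t *\<^sub>R k + s *\<^sub>R h)"
      by (metis add.assoc add_diff_cancel_left' norm_minus_commute)
    then show "x + t *\<^sub>R k + s *\<^sub>R h \<in> cball x R" using bd(2)[OF that] t(2) by (simp add: dist_norm)
  qed
  have "(\<phi> has_real_derivative \<phi>' s) (at s)" if "0 \<le> s" "s \<le> t" for s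
    unfolding \<phi>_def \<phi>'_def using inR[OF that] R
    by (intro DERIV_diff smooth_compose_has_vector_derivative[OF f]) (auto intro!: derivative_eq_intros)
  then obtain \<xi> where \<xi>: "0 < \<xi>" "\<xi> < t" "\<phi> t - \<phi> 0 = (t - 0) * \<phi>' \<xi>"
    using MVT2[OF \<open>t > 0\<close>, of \<phi> \<phi>'] by blast
  have \<xi>': "0 \<le> \<xi>" "\<xi> \<le> t" using \<xi> by auto
  let ?b = "t * (norm h + norm k)"
  have e1: "\<bar>grad f (x + t *\<^sub>R k + \<xi> *\<^sub>R h) \<bullet> h - grad f x \<bullet> h - hess f x (t *\<^sub>R k + \<xi> *\<^sub>R h) h\<bar> \<le> C * ?b\<^sup>2 * norm h"
  proof -
    have "\<bar>grad f (x + t *\<^sub>R k + \<xi> *\<^sub>R h) \<bullet> h - grad f x \<bullet> h - hess f x (t *\<^sub>R k + \<xi> *\<^sub>R h) h\<bar>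
       \<le> C * (norm (t *\<^sub>R k + \<xi> *\<^sub>R h))\<^sup>2 * norm h"
      using C(2)[OF inR(2)[OF \<xi>'], of h] by (simp add: add.assoc)
    also have "\<dots> \<le> C * ?b\<^sup>2 * norm h"
      using C(1) bd(2)[OF \<xi>'] by (intro mult_right_mono mult_left_mono power_mono) auto
    finally show ?thesis .
  qed
  have e2: "\<bar>grad f (x + \<xi> *\<^sub>R h) \<bullet> h - grad f x \<bullet> h - hess f x (\<xi> *\<^sub>R h) h\<bar> \<le> C * ?b\<^sup>2 * norm h"
  proof -
    have "\<bar>grad f (x + \<xi> *\<^sub>R h) \<bullet> h - grad f x \<bullet> h - hess f x (\<xi> *\<^sub>R h) h\<bar>
       \<le> C * (norm (\<xi> *\<^sub>R h))\<^sup>2 * norm h"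
      using C(2)[OF inR(1)[OF \<xi>'], of h] by (simp only: add_diff_cancel_left')
    also have "\<dots> \<le> C * ?b\<^sup>2 * norm h"
      using C(1) bd(1)[OF \<xi>'] by (intro mult_right_mono mult_left_mono power_mono) auto
    finally show ?thesis .
  qed
  have "\<bar>\<phi>' \<xi> - t * hess f x k h\<bar> \<le> 2 * C * ?b\<^sup>2 * norm h"
    using e1 e2 unfolding \<phi>'_def by (simp add: hess_add_left hess_scaleR_left)
  then have "t * \<bar>\<phi>' \<xi> - t * hess f x k h\<bar> \<le> t * (2 * C * ?b\<^sup>2 * norm h)"
    using t by (intro mult_left_mono) auto
  moreover have "f (x + t *\<^sub>R h + t *\<^sub>R k) - f (x + t *\<^sub>R h) - f (x + t *\<^sub>R k) + f x - t\<^sup>2 * hess f x k h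
      = t * (\<phi>' \<xi> - t * hess f x k h)"
    using \<xi>(3) by (simp add: \<phi>_def algebra_simps power2_eq_square)
  ultimately show ?thesis using t
    by (simp add: abs_mult power_mult_distrib power2_eq_square power3_eq_cube mult_ac)
qed

text \<open>The second difference is symmetric in \<open>h\<close> and \<open>k\<close>, whereas the
  estimate yields either order of the arguments of \<open>hess\<close>, according to the roles given
  to the two vectors.\<close>

lemma hess_sym:
  assumes f: "smooth_fun_on M f" "open M" "x \<in> M"
  shows "hess f x h k = hess f x k h"
proof (rule ccontr)
  assume "hess f x h k \<noteq> hess f x k h"
  then have d: "\<bar>hess f x h k - hess f x k h\<bar> > 0" (is "?d > 0") by simp
  obtain R where R: "R > 0" "cball x R \<subseteq> M" using f open_contains_cball by blast
  obtain C where C: "C > 0" "\<And>y k. y \<in> cball x R \<Longrightarrow>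
       \<bar>grad f y \<bullet> k - grad f x \<bullet> k - hess f x (y - x) k\<bar> \<le> C * (norm (y - x))\<^sup>2 * norm k"
    using smooth_hess_estimate[OF f(1,2) compact_cball convex_cball R(2)] R(1)
    by (metis centre_in_cball less_imp_le)
  define N where "N = norm h + norm k"
  define E where "E = 2 * C * N\<^sup>2 * norm h + 2 * C * N\<^sup>2 * norm k"
  have N0: "N \<ge> 0" and E0: "E \<ge> 0" using C by (auto simp: N_def E_def)
  \<comment> \<open>The first bound keeps all four points in the ball, the second pushes the cubic
    error below \<open>t\<^sup>2\<close> times the assumed gap.\<close>
  define t where "t = min (R / (N + 1)) (?d / (2 * (E + 1)))"
  have t: "t > 0" "t * N \<le> R" "t * E < ?d"
  proof -
    show "t > 0" using R d N0 E0 by (auto simp: t_def)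
    have "t * N \<le> t * (N + 1)" using \<open>t > 0\<close> by (intro mult_left_mono) auto
    also have "\<dots> \<le> R / (N + 1) * (N + 1)" using N0 by (intro mult_right_mono) (auto simp: t_def)
    finally show "t * N \<le> R" using N0 by simp
    have "t * E \<le> t * (E + 1)" using \<open>t > 0\<close> by (intro mult_left_mono) auto
    also have "\<dots> \<le> ?d / (2 * (E + 1)) * (E + 1)" using E0 by (intro mult_right_mono) (auto simp: t_def)
    also have "\<dots> = ?d / 2" using E0 by (simp add: field_simps)
    also have "\<dots> < ?d" using d by simp
    finally show "t * E < ?d" .
  qed
  let ?D = "f (x + t *\<^sub>R h + t *\<^sub>R k) - f (x + t *\<^sub>R h) - f (x + t *\<^sub>R k) + f x"
  have "\<bar>?D - t\<^sup>2 * hess f x k h\<bar> \<le> t ^ 3 * (2 * C * N\<^sup>2 * norm h)"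
    using second_difference_estimate[OF f(1,2) R(2) t(1) _ C, of h k] t(2) by (simp add: N_def)
  moreover have "\<bar>?D - t\<^sup>2 * hess f x h k\<bar> \<le> t ^ 3 * (2 * C * N\<^sup>2 * norm k)"
    using second_difference_estimate[OF f(1,2) R(2) t(1) _ C, of k h] t(2)
    by (simp add: N_def add_ac algebra_simps)
  ultimately have "\<bar>t\<^sup>2 * hess f x h k - t\<^sup>2 * hess f x k h\<bar> \<le> t ^ 3 * E"
    unfolding E_def distrib_left by linarith
  then have "t\<^sup>2 * ?d \<le> t\<^sup>2 * (t * E)"
    by (simp add: abs_mult power2_eq_square power3_eq_cube mult.assoc flip: right_diff_distrib)
  then show False using t by simp
qed

text \<open>For a geodesic \<open>\<gamma>\<close> with velocity \<open>w\<close>, where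
  \<open>w'\<close> is minus the Christoffel term, the derivative is the covariant Hessian in the
  direction \<open>w\<close>.\<close>

lemma smooth_grad_compose_has_derivative:
  assumes f: "smooth_fun_on M f" "open M" "\<gamma> t \<in> M"
    and \<gamma>: "(\<gamma> has_vector_derivative v) (at t within T)" and w: "(w has_vector_derivative w') (at t within T)"
  shows "((\<lambda>s. grad f (\<gamma> s) \<bullet> w s) has_real_derivative (hess f (\<gamma> t) v (w t) + grad f (\<gamma> t) \<bullet> w')) (at t within T)"
proof -
  have [derivative_intros]: "((\<lambda>s. w s $ i) has_real_derivative w' $ i) (at t within T)" for i
    using bounded_linear.has_vector_derivative[OF bounded_linear_vec_nth w]
    by (simp add: has_real_derivative_iff_has_vector_derivative)
  have "((\<lambda>s. \<Sum>i\<in>UNIV. partial_deriv i f (\<gamma> s) * w s $ i) has_real_derivative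
      (\<Sum>i\<in>UNIV. partial_deriv i f (\<gamma> t) * w' $ i + (grad (partial_deriv i f) (\<gamma> t) \<bullet> v) * w t $ i)) (at t within T)"
    by (intro DERIV_sum DERIV_mult' derivative_intros
        smooth_compose_has_vector_derivative[OF smooth_fun_on_partial[OF f(1)] f(2,3) \<gamma>])
  then show ?thesis
    by (simp add: grad_def inner_vec_def hess_def sum.distrib mult.commute add.commute)
qed

section \<open>Metric and connection\<close>

text \<open>Contraction of the connection with two vectors: a field \<open>w\<close> along a curve
  with velocity \<open>v\<close> has covariant derivative
  \<open>w' + christoffel \<Gamma> x v w\<close>, and geodesics satisfy
  \<open>v' = - christoffel \<Gamma> x v v\<close>.\<close>

definition christoffel :: "('n \<Rightarrow> 'n \<Rightarrow> 'n \<Rightarrow> real ^ 'n \<Rightarrow> real) \<Rightarrow> real ^ 'n \<Rightarrow> real ^ 'n \<Rightarrow> real ^ 'n \<Rightarrow> real ^ 'n" where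
  "christoffel \<Gamma> x v w = (\<chi> m. \<Sum>i\<in>UNIV. \<Sum>j\<in>UNIV. \<Gamma> m i j x * v $ i * w $ j)"

lemma bounded_bilinear_christoffel: "bounded_bilinear (christoffel \<Gamma> x)"
  unfolding bilinear_conv_bounded_bilinear[symmetric] bilinear_def
  by (auto simp: christoffel_def vec_eq_iff algebra_simps sum.distrib sum_distrib_left intro!: linearI)

lemma bounded_bilinear_metric_form: "bounded_bilinear (metric_form g x)"
  unfolding metric_form_def
  by (rule bounded_bilinear.comp[OF bounded_bilinear_inner bounded_linear_ident matrix_vector_mul_bounded_linear])

lemma metric_form_sum: "metric_form g x v w = (\<Sum>i\<in>UNIV. \<Sum>j\<in>UNIV. v $ i * g x $ i $ j * w $ j)"
  by (simp add: metric_form_def inner_vec_def matrix_vector_mult_def sum_distrib_left mult.assoc)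

lemmas metric_form_add_left = bounded_bilinear.add_left[OF bounded_bilinear_metric_form]
lemmas metric_form_add_right = bounded_bilinear.add_right[OF bounded_bilinear_metric_form]
lemmas metric_form_diff_left = bounded_bilinear.diff_left[OF bounded_bilinear_metric_form]
lemmas metric_form_diff_right = bounded_bilinear.diff_right[OF bounded_bilinear_metric_form]
lemmas metric_form_minus_left = bounded_bilinear.minus_left[OF bounded_bilinear_metric_form]
lemmas metric_form_minus_right = bounded_bilinear.minus_right[OF bounded_bilinear_metric_form]
lemmas metric_form_scaleR_left = bounded_bilinear.scaleR_left[OF bounded_bilinear_metric_form]
lemmas metric_form_scaleR_right = bounded_bilinear.scaleR_right[OF bounded_bilinear_metric_form]

lemmas metric_form_bilinear_simps = metric_form_add_left metric_form_add_right metric_form_diff_left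
  metric_form_diff_right metric_form_minus_left metric_form_minus_right
  metric_form_scaleR_left metric_form_scaleR_right

lemmas christoffel_add_left = bounded_bilinear.add_left[OF bounded_bilinear_christoffel]
lemmas christoffel_add_right = bounded_bilinear.add_right[OF bounded_bilinear_christoffel]
lemmas christoffel_scaleR_left = bounded_bilinear.scaleR_left[OF bounded_bilinear_christoffel]
lemmas christoffel_scaleR_right = bounded_bilinear.scaleR_right[OF bounded_bilinear_christoffel]

text \<open>Axiom 1 alone: what is shown about shortest curves and the distance is independent of
  the probability distribution.\<close>

locale levi_civita_metric =
  fixes M :: "(real ^ 'n) set" and g :: "real ^ 'n \<Rightarrow> real ^ 'n ^ 'n"
    and \<Gamma> :: "'n \<Rightarrow> 'n \<Rightarrow> 'n \<Rightarrow> real ^ 'n \<Rightarrow> real"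
  assumes open_M: "open M"
    and riemannian: "riemannian_metric_on M g"
    and levi_civita: "levi_civita_on M g \<Gamma>"
begin

abbreviation G where "G \<equiv> metric_form g"
abbreviation B where "B \<equiv> christoffel \<Gamma>"

lemma smooth_g: "smooth_fun_on M (\<lambda>x. g x $ i $ j)"
  using riemannian unfolding riemannian_metric_on_def by blast

lemma smooth_\<Gamma>: "smooth_fun_on M (\<Gamma> m i j)"
  using levi_civita unfolding levi_civita_on_def by blast

lemma g_sym:
  assumes "x \<in> M"
  shows "g x $ i $ j = g x $ j $ i"
proof -
  have "transpose (g x) = g x"
    using riemannian assms unfolding riemannian_metric_on_def by blast
  then have "transpose (g x) $ j $ i = g x $ j $ i" by (rule arg_cong)
  then show ?thesis by (simp add: Finite_Cartesian_Product.transpose_def)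
qed

lemma G_sym: "x \<in> M \<Longrightarrow> G x v w = G x w v"
  unfolding metric_form_sum
  by (subst sum.swap) (simp add: g_sym[of x] mult_ac)

lemma G_pos: "x \<in> M \<Longrightarrow> v \<noteq> 0 \<Longrightarrow> G x v v > 0"
  using riemannian unfolding riemannian_metric_on_def by blast

lemma G_nonneg: "x \<in> M \<Longrightarrow> G x v v \<ge> 0"
  using G_pos[of x v] by (cases "v = 0") (auto simp: metric_form_sum)

lemma B_sym: "x \<in> M \<Longrightarrow> B x v w = B x w v"
proof -
  assume "x \<in> M"
  then have "\<Gamma> m i j x = \<Gamma> m j i x" for m i j
    using levi_civita unfolding levi_civita_on_def by blast
  then show ?thesis
    unfolding christoffel_def vec_eq_iff vec_lambda_beta
    by (intro allI, subst sum.swap) (simp add: mult_ac)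
qed

lemma grad_g:
  assumes "x \<in> M"
  shows "grad (\<lambda>y. g y $ i $ j) x \<bullet> h = (\<Sum>m\<in>UNIV. (\<Sum>k\<in>UNIV. \<Gamma> m k i x * h $ k) * g x $ m $ j)
     + (\<Sum>m\<in>UNIV. (\<Sum>k\<in>UNIV. \<Gamma> m k j x * h $ k) * g x $ i $ m)"
proof -
  have "partial_deriv k (\<lambda>y. g y $ i $ j) x
     = (\<Sum>m\<in>UNIV. \<Gamma> m k i x * g x $ m $ j) + (\<Sum>m\<in>UNIV. \<Gamma> m k j x * g x $ i $ m)" for k
  proof -
    have "partial_deriv k (\<lambda>y. g y $ i $ j) x - (\<Sum>m\<in>UNIV. \<Gamma> m k i x * g x $ m $ j)
       - (\<Sum>m\<in>UNIV. \<Gamma> m k j x * g x $ i $ m) = 0"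
      using levi_civita assms unfolding levi_civita_on_def by blast
    then show ?thesis by linarith
  qed
  then have "grad (\<lambda>y. g y $ i $ j) x \<bullet> h = (\<Sum>k\<in>UNIV. (\<Sum>m\<in>UNIV. \<Gamma> m k i x * h $ k * g x $ m $ j)
      + (\<Sum>m\<in>UNIV. \<Gamma> m k j x * h $ k * g x $ i $ m))"
    by (simp add: grad_def inner_vec_def sum_distrib_left distrib_left sum_distrib_right distrib_right mult_ac)
  also have "\<dots> = (\<Sum>m\<in>UNIV. \<Sum>k\<in>UNIV. \<Gamma> m k i x * h $ k * g x $ m $ j)
      + (\<Sum>m\<in>UNIV. \<Sum>k\<in>UNIV. \<Gamma> m k j x * h $ k * g x $ i $ m)"
    unfolding sum.distrib by (intro arg_cong2[where f="(+)"] sum.swap)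
  finally show ?thesis by (simp add: sum_distrib_right)
qed

text \<open>Contracting \<open>D g = 0\<close> with three vectors removes the indices, so that later
  computations can be carried out with the bilinear maps \<open>G\<close> and
  \<open>B\<close>.\<close>

lemma metric_compat:
  assumes "x \<in> M"
  shows "(\<Sum>i\<in>UNIV. \<Sum>j\<in>UNIV. v $ i * (grad (\<lambda>y. g y $ i $ j) x \<bullet> h) * w $ j)
    = G x (B x h v) w + G x v (B x h w)"
proof -
  define c where "c m i = (\<Sum>k\<in>UNIV. \<Gamma> m k i x * h $ k)" for m i
  have B: "B x h v $ m = (\<Sum>i\<in>UNIV. c m i * v $ i)" for m v
    unfolding christoffel_def c_def vec_lambda_beta
    by (subst sum.swap) (simp add: sum_distrib_right)
  have "(\<Sum>i\<in>UNIV. \<Sum>j\<in>UNIV. v $ i * (grad (\<lambda>y. g y $ i $ j) x \<bullet> h) * w $ j)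
     = (\<Sum>i\<in>UNIV. \<Sum>j\<in>UNIV. \<Sum>m\<in>UNIV. v $ i * c m i * g x $ m $ j * w $ j) 
     + (\<Sum>i\<in>UNIV. \<Sum>j\<in>UNIV. \<Sum>m\<in>UNIV. v $ i * c m j * g x $ i $ m * w $ j)"
    unfolding grad_g[OF assms] c_def[symmetric]
    by (simp add: distrib_left distrib_right sum.distrib sum_distrib_left sum_distrib_right mult_ac)
  also have "(\<Sum>i\<in>UNIV. \<Sum>j\<in>UNIV. \<Sum>m\<in>UNIV. v $ i * c m i * g x $ m $ j * w $ j) 
     = (\<Sum>m\<in>UNIV. \<Sum>j\<in>UNIV. \<Sum>i\<in>UNIV. v $ i * c m i * g x $ m $ j * w $ j)"
  proof -
    have "(\<Sum>i\<in>UNIV. \<Sum>j\<in>UNIV. \<Sum>m\<in>UNIV. v $ i * c m i * g x $ m $ j * w $ j) 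
       = (\<Sum>i\<in>UNIV. \<Sum>m\<in>UNIV. \<Sum>j\<in>UNIV. v $ i * c m i * g x $ m $ j * w $ j)"
      by (intro sum.cong refl sum.swap)
    also have "\<dots> = (\<Sum>m\<in>UNIV. \<Sum>i\<in>UNIV. \<Sum>j\<in>UNIV. v $ i * c m i * g x $ m $ j * w $ j)"
      by (rule sum.swap)
    also have "\<dots> = (\<Sum>m\<in>UNIV. \<Sum>j\<in>UNIV. \<Sum>i\<in>UNIV. v $ i * c m i * g x $ m $ j * w $ j)"
      by (intro sum.cong refl sum.swap)
    finally show ?thesis .
  qed
  also have "\<dots> = G x (B x h v) w"
    unfolding metric_form_sum B by (simp add: sum_distrib_left sum_distrib_right mult_ac)
  also have "(\<Sum>i\<in>UNIV. \<Sum>j\<in>UNIV. \<Sum>m\<in>UNIV. v $ i * c m j * g x $ i $ m * w $ j)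
     = (\<Sum>i\<in>UNIV. \<Sum>m\<in>UNIV. \<Sum>j\<in>UNIV. v $ i * c m j * g x $ i $ m * w $ j)"
    by (intro sum.cong refl sum.swap)
  also have "\<dots> = G x v (B x h w)"
    unfolding metric_form_sum B by (simp add: sum_distrib_left sum_distrib_right mult_ac)
  finally show ?thesis .
qed

text \<open>This is the product rule of the covariant derivative:
  \<open>B (\<gamma> t) c (u t) + u'\<close> is the covariant derivative of \<open>u\<close> along
  \<open>\<gamma>\<close>. It vanishes for the velocity of a geodesic, which makes the speed
  constant and removes the acceleration from the calibration.\<close>

lemma G_compose_has_derivative:
  assumes "\<gamma> t \<in> M" and \<gamma>: "(\<gamma> has_vector_derivative c) (at t within T)"
    and u: "(u has_vector_derivative u') (at t within T)" and w: "(w has_vector_derivative w') (at t within T)"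
  shows "((\<lambda>s. G (\<gamma> s) (u s) (w s)) has_real_derivative
     (G (\<gamma> t) (B (\<gamma> t) c (u t) + u') (w t) + G (\<gamma> t) (u t) (B (\<gamma> t) c (w t) + w'))) (at t within T)"
proof -
  have comp: "((\<lambda>s. u s $ i) has_real_derivative u' $ i) (at t within T)"
    if "(u has_vector_derivative u') (at t within T)" for i u u'
    using bounded_linear.has_vector_derivative[OF bounded_linear_vec_nth that]
    by (simp add: has_real_derivative_iff_has_vector_derivative)
  have "((\<lambda>s. G (\<gamma> s) (u s) (w s)) has_real_derivative 
      (\<Sum>i\<in>UNIV. \<Sum>j\<in>UNIV. u t $ i * g (\<gamma> t) $ i $ j * w' $ j
        + (u t $ i * (grad (\<lambda>y. g y $ i $ j) (\<gamma> t) \<bullet> c) + u' $ i * g (\<gamma> t) $ i $ j) * w t $ j)) (at t within T)"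
    unfolding metric_form_sum
    by (intro DERIV_sum DERIV_mult' comp u w smooth_compose_has_vector_derivative[OF smooth_g open_M assms(1) \<gamma>])
  also have "(\<Sum>i\<in>UNIV. \<Sum>j\<in>UNIV. u t $ i * g (\<gamma> t) $ i $ j * w' $ j
        + (u t $ i * (grad (\<lambda>y. g y $ i $ j) (\<gamma> t) \<bullet> c) + u' $ i * g (\<gamma> t) $ i $ j) * w t $ j)
     = G (\<gamma> t) (u t) w' + ((\<Sum>i\<in>UNIV. \<Sum>j\<in>UNIV. u t $ i * (grad (\<lambda>y. g y $ i $ j) (\<gamma> t) \<bullet> c) * w t $ j)
        + G (\<gamma> t) u' (w t))"
    by (simp add: metric_form_sum sum.distrib distrib_right)
  also have "\<dots> = G (\<gamma> t) (B (\<gamma> t) c (u t) + u') (w t) + G (\<gamma> t) (u t) (B (\<gamma> t) c (w t) + w')"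
    unfolding metric_compat[OF assms(1)] by (simp add: metric_form_bilinear_simps)
  finally show ?thesis .
qed

section \<open>Uniform estimates for the metric on compact sets\<close>

text \<open>By homogeneity it suffices to bound \<open>G\<close> from below on the compact set of
  Euclidean unit vectors over \<open>K\<close>, where it is continuous and positive.\<close>

lemma G_positive_on_compact:
  assumes "compact K" "K \<subseteq> M"
  obtains m where "m > 0" "\<And>x v. x \<in> K \<Longrightarrow> G x v v \<ge> m * (norm v)\<^sup>2"
proof (cases "K = {}")
  case False
  let ?S = "sphere 0 1 :: (real ^ 'n) set"
  have c: "continuous_on (K \<times> ?S) (\<lambda>(x, v). G x v v)"
    unfolding metric_form_sum case_prod_unfold
    by (intro continuous_intros continuous_on_compose2[OF smooth_fun_on_continuous[OF smooth_g]])
      (use assms in auto)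
  have "axis undefined 1 \<in> ?S" by simp
  then have "K \<times> ?S \<noteq> {}" using False by blast
  then obtain p where p: "p \<in> K \<times> ?S" "\<And>q. q \<in> K \<times> ?S \<Longrightarrow> (\<lambda>(x, v). G x v v) p \<le> (\<lambda>(x, v). G x v v) q"
    using continuous_attains_inf[OF compact_Times[OF assms(1) compact_sphere] _ c] by blast
  obtain x0 v0 where p_eq: "p = (x0, v0)" by (cases p)
  show thesis
  proof
    show "G x0 v0 v0 > 0" using p p_eq assms by (intro G_pos) auto
    fix x v assume x: "x \<in> K"
    show "G x v v \<ge> G x0 v0 v0 * (norm v)\<^sup>2"
    proof (cases "v = 0")
      case False
      have "G x0 v0 v0 \<le> G x (v /\<^sub>R norm v) (v /\<^sub>R norm v)"
        using p(2)[of "(x, v /\<^sub>R norm v)"] x False by (simp add: p_eq)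
      also have "\<dots> = G x v v / (norm v)\<^sup>2" by (simp add: metric_form_bilinear_simps power2_eq_square field_simps)
      finally show ?thesis using False by (simp add: field_simps)
    qed (simp add: metric_form_bilinear_simps metric_form_sum)
  qed
qed (use that[of 1] in auto)

text \<open>The first estimate is a Lipschitz bound, the second Taylor's formula. Its linear term is
  expressed by the connection through \<open>metric_compat\<close>; the symmetries of
  \<open>G\<close> and \<open>B\<close> bring it into the form that also occurs in the derivative of
  the calibration.\<close>

lemma G_estimates_on_compact:
  assumes "compact K" "convex K" "K \<subseteq> M"
  obtains C where "C > 0" 
    "\<And>x y v w. x \<in> K \<Longrightarrow> y \<in> K \<Longrightarrow> \<bar>G y v w - G x v w\<bar> \<le> C * norm (y - x) * norm v * norm w"
    "\<And>x y v w. x \<in> K \<Longrightarrow> y \<in> K \<Longrightarrow>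
        \<bar>G y v v - G x v v - 2 * G x v (B x v (y - x))\<bar> \<le> C * (norm (y - x))\<^sup>2 * (norm v)\<^sup>2"
proof -
  have "\<exists>C>0. \<forall>x\<in>K. \<forall>y\<in>K. \<bar>g y $ i $ j - g x $ i $ j\<bar> \<le> C * norm (y - x) \<and>
      \<bar>g y $ i $ j - g x $ i $ j - grad (\<lambda>x. g x $ i $ j) x \<bullet> (y - x)\<bar> \<le> C * (norm (y - x))\<^sup>2" for i j
    using smooth_lipschitz_taylor2[OF smooth_g[of i j] open_M assms] by metis
  then obtain c where c: "\<And>i j. c i j > 0"
    "\<And>i j x y. x \<in> K \<Longrightarrow> y \<in> K \<Longrightarrow> \<bar>g y $ i $ j - g x $ i $ j\<bar> \<le> c i j * norm (y - x)"
    "\<And>i j x y. x \<in> K \<Longrightarrow> y \<in> K \<Longrightarrow> 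
       \<bar>g y $ i $ j - g x $ i $ j - grad (\<lambda>x. g x $ i $ j) x \<bullet> (y - x)\<bar> \<le> c i j * (norm (y - x))\<^sup>2"
    by metis
  define C where "C = (\<Sum>i\<in>UNIV. \<Sum>j\<in>UNIV. c i j)"
  have bd: "\<bar>\<Sum>i\<in>UNIV. \<Sum>j\<in>UNIV. v $ i * a i j * w $ j\<bar> \<le> C * b * norm v * norm w"
    if "\<And>i j. \<bar>a i j\<bar> \<le> c i j * b" "b \<ge> 0" for a b and v w :: "real ^ 'n"
  proof -
    have "\<bar>\<Sum>i\<in>UNIV. \<Sum>j\<in>UNIV. v $ i * a i j * w $ j\<bar> \<le> (\<Sum>i\<in>UNIV. \<Sum>j\<in>UNIV. \<bar>v $ i * a i j * w $ j\<bar>)"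
      by (rule order_trans[OF sum_abs]) (intro sum_mono sum_abs)
    also have "\<dots> \<le> (\<Sum>i\<in>UNIV. \<Sum>j\<in>UNIV. norm v * (c i j * b) * norm w)"
      unfolding abs_mult using that less_imp_le[OF c(1)]
      by (intro sum_mono mult_mono component_le_norm_cart) auto
    also have "\<dots> = C * b * norm v * norm w"
      by (simp add: C_def sum_distrib_right sum_distrib_left mult_ac)
    finally show ?thesis .
  qed
  show thesis
  proof
    show "C > 0" unfolding C_def using c(1) by (intro sum_pos) auto
  next
    fix x y v w assume xy: "x \<in> K" "y \<in> K"
    have "G y v w - G x v w = (\<Sum>i\<in>UNIV. \<Sum>j\<in>UNIV. v $ i * (g y $ i $ j - g x $ i $ j) * w $ j)"
      by (simp add: metric_form_sum left_diff_distrib right_diff_distrib sum_subtractf)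
    then show "\<bar>G y v w - G x v w\<bar> \<le> C * norm (y - x) * norm v * norm w"
      using bd[OF c(2)[OF xy]] by simp
    have "x \<in> M" using xy assms by auto
    have "2 * G x v (B x v (y - x)) = G x (B x (y - x) v) v + G x v (B x (y - x) v)"
      using \<open>x \<in> M\<close> by (simp add: G_sym[of x _ v] B_sym[of x v])
    also have "\<dots> = (\<Sum>i\<in>UNIV. \<Sum>j\<in>UNIV. v $ i * (grad (\<lambda>y. g y $ i $ j) x \<bullet> (y - x)) * v $ j)"
      by (simp add: metric_compat[OF \<open>x \<in> M\<close>])
    finally have "G y v v - G x v v - 2 * G x v (B x v (y - x)) 
      = (\<Sum>i\<in>UNIV. \<Sum>j\<in>UNIV. v $ i * (g y $ i $ j - g x $ i $ j - grad (\<lambda>y. g y $ i $ j) x \<bullet> (y - x)) * v $ j)"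
      by (simp add: metric_form_sum left_diff_distrib right_diff_distrib sum_subtractf)
    then show "\<bar>G y v v - G x v v - 2 * G x v (B x v (y - x))\<bar> \<le> C * (norm (y - x))\<^sup>2 * (norm v)\<^sup>2"
      using bd[OF c(3)[OF xy], of v v] by (simp add: power2_eq_square mult_ac)
  qed
qed

section \<open>Geodesics are locally shortest\<close>

text \<open>The field is quadratic in the velocity, so the Lipschitz bound is obtained on a bounded
  set; \<open>U\<close> bounds the velocities that occur in the ball.\<close>

lemma geodesic_field_lipschitz:
  assumes "cball p r \<subseteq> M"
  obtains L where "L-lipschitz_on (cball (p, v) r) (\<lambda>(x, w). (w, - B x w w))"
proof -
  have "\<exists>c>0. (\<forall>x\<in>cball p r. \<bar>\<Gamma> m i j x\<bar> \<le> c) \<and>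
      (\<forall>x\<in>cball p r. \<forall>y\<in>cball p r. \<bar>\<Gamma> m i j y - \<Gamma> m i j x\<bar> \<le> c * norm (y - x))" for m i j
  proof -
    obtain c1 where c1: "c1 > 0" "\<And>x. x \<in> cball p r \<Longrightarrow> \<bar>\<Gamma> m i j x\<bar> \<le> c1"
      using smooth_bounded[OF smooth_\<Gamma> compact_cball assms] by metis
    obtain c2 where c2: "c2 > 0"
      "\<And>x y. x \<in> cball p r \<Longrightarrow> y \<in> cball p r \<Longrightarrow> \<bar>\<Gamma> m i j y - \<Gamma> m i j x\<bar> \<le> c2 * norm (y - x)"
      using smooth_lipschitz[OF smooth_\<Gamma> open_M compact_cball convex_cball assms] by metis
    have "\<bar>\<Gamma> m i j y - \<Gamma> m i j x\<bar> \<le> max c1 c2 * norm (y - x)" if "x \<in> cball p r" "y \<in> cball p r" for x y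
      using c2(2)[OF that] by (rule order_trans) (intro mult_right_mono, auto)
    moreover have "\<bar>\<Gamma> m i j x\<bar> \<le> max c1 c2" if "x \<in> cball p r" for x
      using c1(2)[OF that] by simp
    ultimately show ?thesis using c1(1) by (intro exI[of _ "max c1 c2"]) auto
  qed
  then obtain c where c: "\<And>m i j. c m i j > 0" "\<And>m i j x. x \<in> cball p r \<Longrightarrow> \<bar>\<Gamma> m i j x\<bar> \<le> c m i j"
      "\<And>m i j x y. x \<in> cball p r \<Longrightarrow> y \<in> cball p r \<Longrightarrow> \<bar>\<Gamma> m i j y - \<Gamma> m i j x\<bar> \<le> c m i j * norm (y - x)"
    by metis
  define U where "U = norm v + \<bar>r\<bar>"
  define C where "C = (\<Sum>m\<in>UNIV. \<Sum>i\<in>UNIV. \<Sum>j\<in>UNIV. c m i j * (U * U + 2 * U))"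
  have U0: "U \<ge> 0" by (simp add: U_def)
  have "(1 + C)-lipschitz_on (cball (p, v) r) (\<lambda>(x, w). (w, - B x w w))"
  proof (rule lipschitz_onI)
    have c0: "0 \<le> c m i j" for m i j using c(1)[of m i j] by simp
    show "0 \<le> 1 + C" unfolding C_def using c0 U0
      by (intro add_nonneg_nonneg sum_nonneg mult_nonneg_nonneg) auto
    fix a b assume ab: "a \<in> cball (p, v) r" "b \<in> cball (p, v) r"
    obtain x w where a: "a = (x, w)" by (cases a)
    obtain y z where b: "b = (y, z)" by (cases b)
    have xy: "x \<in> cball p r" "y \<in> cball p r"
      using ab dist_fst_le[of "(p, v)" a] dist_fst_le[of "(p, v)" b] by (auto simp: a b)
    have wz: "norm w \<le> U" "norm z \<le> U"
    proof -
      have "dist v w \<le> r" "dist v z \<le> r"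
        using ab dist_snd_le[of "(p, v)" a] dist_snd_le[of "(p, v)" b] by (auto simp: a b)
      then show "norm w \<le> U" "norm z \<le> U"
        using norm_triangle_ineq2[of w v] norm_triangle_ineq2[of z v]
        by (auto simp: U_def dist_norm norm_minus_commute)
    qed
    let ?D = "dist a b"
    have D: "norm (y - x) \<le> ?D" "norm (z - w) \<le> ?D"
      using dist_fst_le[of a b] dist_snd_le[of a b] by (auto simp: a b dist_norm norm_minus_commute)
    have t: "\<bar>\<Gamma> m i j y * z $ i * z $ j - \<Gamma> m i j x * w $ i * w $ j\<bar> \<le> c m i j * (U * U + 2 * U) * ?D" for m i j
    proof -
      \<comment> \<open>Telescoping: each of the three products contains exactly one difference. The
        first contributes \<open>U * U\<close> to the constant, the other two \<open>U\<close>
        each.\<close>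
      have "\<Gamma> m i j y * z $ i * z $ j - \<Gamma> m i j x * w $ i * w $ j
         = (\<Gamma> m i j y - \<Gamma> m i j x) * (z $ i * z $ j) + \<Gamma> m i j x * ((z - w) $ i * z $ j)
         + \<Gamma> m i j x * (w $ i * (z - w) $ j)" by (simp add: algebra_simps)
      also have "\<bar>\<dots>\<bar> \<le> \<bar>(\<Gamma> m i j y - \<Gamma> m i j x) * (z $ i * z $ j)\<bar> + \<bar>\<Gamma> m i j x * ((z - w) $ i * z $ j)\<bar>
         + \<bar>\<Gamma> m i j x * (w $ i * (z - w) $ j)\<bar>" by linarith
      also have "\<dots> \<le> (c m i j * ?D) * (U * U) + c m i j * (?D * U) + c m i j * (U * ?D)"
      proof (intro add_mono)
        have comp: "\<bar>w $ i\<bar> \<le> U" "\<bar>z $ i\<bar> \<le> U" "\<bar>(z - w) $ i\<bar> \<le> ?D" for i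
          using component_le_norm_cart[of w i] component_le_norm_cart[of z i]
            component_le_norm_cart[of "z - w" i] wz D by linarith+
        have "\<bar>\<Gamma> m i j y - \<Gamma> m i j x\<bar> \<le> c m i j * ?D"
          using c(3)[OF xy, of m i j] mult_left_mono[OF D(1) c0[of m i j]] by linarith
        then show "\<bar>(\<Gamma> m i j y - \<Gamma> m i j x) * (z $ i * z $ j)\<bar> \<le> (c m i j * ?D) * (U * U)"
          unfolding abs_mult using U0 comp c0[of m i j] by (intro mult_mono mult_nonneg_nonneg) auto
        show "\<bar>\<Gamma> m i j x * ((z - w) $ i * z $ j)\<bar> \<le> c m i j * (?D * U)"
          unfolding abs_mult using U0 comp c0[of m i j] c(2)[OF xy(1)]
          by (intro mult_mono mult_nonneg_nonneg) auto
        show "\<bar>\<Gamma> m i j x * (w $ i * (z - w) $ j)\<bar> \<le> c m i j * (U * ?D)"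
          unfolding abs_mult using U0 comp c0[of m i j] c(2)[OF xy(1)]
          by (intro mult_mono mult_nonneg_nonneg) auto
      qed
      also have "\<dots> = c m i j * (U * U + 2 * U) * ?D" by (simp add: algebra_simps)
      finally show ?thesis .
    qed
    have "norm (B y z z - B x w w) \<le> (\<Sum>m\<in>UNIV. \<bar>(B y z z - B x w w) $ m\<bar>)" by (rule norm_le_l1_cart)
    also have "\<dots> = (\<Sum>m\<in>UNIV. \<bar>\<Sum>i\<in>UNIV. \<Sum>j\<in>UNIV. \<Gamma> m i j y * z $ i * z $ j - \<Gamma> m i j x * w $ i * w $ j\<bar>)"
      by (simp add: christoffel_def sum_subtractf)
    also have "\<dots> \<le> (\<Sum>m\<in>UNIV. \<Sum>i\<in>UNIV. \<Sum>j\<in>UNIV. c m i j * (U * U + 2 * U) * ?D)"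
      by (intro sum_mono order_trans[OF sum_abs] t)
    also have "\<dots> = C * ?D" by (simp add: C_def sum_distrib_right)
    finally have "norm (B y z z - B x w w) \<le> C * ?D" .
    moreover have "dist ((\<lambda>(x, w). (w, - B x w w)) a) ((\<lambda>(x, w). (w, - B x w w)) b)
        = norm (w - z, B y z z - B x w w)"
      by (simp add: a b dist_norm)
    moreover have "\<dots> \<le> norm (w - z) + norm (B y z z - B x w w)" by (rule norm_Pair_le)
    ultimately show "dist ((\<lambda>(x, w). (w, - B x w w)) a) ((\<lambda>(x, w). (w, - B x w w)) b) \<le> (1 + C) * ?D"
      using D(2) by (simp add: norm_minus_commute algebra_simps)
  qed
  then show thesis using that by blast
qed

lemma geodesic_equation_solvable:
  assumes "p \<in> M"
  obtains \<delta> \<gamma> u where "\<delta> > 0" "\<gamma> 0 = p" "u 0 = v" "\<And>t. \<bar>t\<bar> < \<delta> \<Longrightarrow> \<gamma> t \<in> M"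
    "\<And>t. \<bar>t\<bar> < \<delta> \<Longrightarrow> (\<gamma> has_vector_derivative u t) (at t)"
    "\<And>t. \<bar>t\<bar> < \<delta> \<Longrightarrow> (u has_vector_derivative - B (\<gamma> t) (u t) (u t)) (at t)"
proof -
  obtain r where r: "r > 0" "cball p r \<subseteq> M" using assms open_M open_contains_cball by blast
  obtain L where L: "L-lipschitz_on (cball (p, v) r) (\<lambda>(x, w). (w, - B x w w))"
    using geodesic_field_lipschitz[OF r(2)] by blast
  obtain \<delta> z where z: "\<delta> > 0" "z 0 = (p, v)"
    "\<And>t. \<bar>t\<bar> < \<delta> \<Longrightarrow> z t \<in> cball (p, v) r"
    "\<And>t. \<bar>t\<bar> < \<delta> \<Longrightarrow> (z has_vector_derivative (\<lambda>(x, w). (w, - B x w w)) (z t)) (at t)"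
    by (rule picard_lindeloef_autonomous[OF L r(1)]) (rule that, assumption+)
  show thesis
  proof (rule that[of \<delta> "\<lambda>t. fst (z t)" "\<lambda>t. snd (z t)"])
    fix t assume t: "\<bar>t\<bar> < \<delta>"
    show "fst (z t) \<in> M"
      using z(3)[OF t] dist_fst_le[of "(p, v)" "z t"] r(2) by auto
    show "((\<lambda>t. fst (z t)) has_vector_derivative snd (z t)) (at t)"
      using bounded_linear.has_vector_derivative[OF bounded_linear_fst z(4)[OF t]]
      by (simp add: case_prod_unfold)
    show "((\<lambda>t. snd (z t)) has_vector_derivative - B (fst (z t)) (snd (z t)) (snd (z t))) (at t)"
      using bounded_linear.has_vector_derivative[OF bounded_linear_snd z(4)[OF t]]
      by (simp add: case_prod_unfold)
  qed (use z in auto)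
qed

section \<open>Lower bounds for the length of curves\<close>

lemma speed_nonneg: "c t \<in> M \<Longrightarrow> speed g c t \<ge> 0"
  unfolding speed_def by (simp add: G_nonneg)

text \<open>The calibration principle: \<open>F\<close> may be any function that grows no faster
  than length along the curve. Stopping at \<open>b'\<close> admits calibrations that are controlled
  only until the curve leaves a region.\<close>

lemma arc_length_ge:
  assumes adm: "admissible_curve M g c a b" and b': "a \<le> b'" "b' \<le> b"
    and F: "continuous_on {a..b'} F" "finite E"
    "\<And>s. s \<in> {a<..<b'} - E \<Longrightarrow> (F has_real_derivative F' s) (at s) \<and> F' s \<le> speed g c s"
  shows "F b' - F a \<le> arc_length g c a b"
proof -
  \<comment> \<open>\<open>F'\<close> is under control only at interior points off \<open>E\<close>.
    Elsewhere it is replaced by the speed, so that the comparison holds at every point, while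
    finitely many values leave the integral unchanged.\<close>
  define H where "H s = (if s \<in> {a<..<b'} - E then F' s else speed g c s)" for s
  have int: "speed g c integrable_on {a..b}" "speed g c integrable_on {a..b'}"
    using adm b' unfolding admissible_curve_def
    by (auto intro: integrable_on_subinterval)
  have "(H has_integral (F b' - F a)) {a..b'}"
  proof (rule fundamental_theorem_of_calculus_interior_strong[OF F(2) b'(1) _ F(1)])
    fix s assume "s \<in> {a<..<b'} - E"
    then show "(F has_vector_derivative H s) (at s)"
      using F(3)[of s] by (simp add: H_def has_real_derivative_iff_has_vector_derivative)
  qed
  then have "F b' - F a \<le> integral {a..b'} (speed g c)"
    by (rule has_integral_le[OF _ integrable_integral[OF int(2)]]) (use F(3) in \<open>auto simp: H_def\<close>)
  also have "\<dots> \<le> arc_length g c a b"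
    unfolding arc_length_def
    by (rule integral_subset_le[OF _ int(2,1)]) (use adm b' speed_nonneg in \<open>auto simp: admissible_curve_def\<close>)
  finally show ?thesis .
qed

lemma admissible_curve_derivative:
  assumes "admissible_curve M g c a b"
  obtains E where "finite E" "continuous_on {a..b} c" "continuous_on ({a..b} - E) (speed g c)"
    "\<And>s. s \<in> {a..b} - E \<Longrightarrow> (c has_vector_derivative vector_derivative c (at s)) (at s)"
proof -
  obtain E where E: "finite E" "c C1_differentiable_on ({a..b} - E)"
    using assms unfolding admissible_curve_def piecewise_C1_differentiable_on_def by blast
  have c: "continuous_on {a..b} c" "c ` {a..b} \<subseteq> M"
    using assms unfolding admissible_curve_def piecewise_C1_differentiable_on_def by auto
  have d: "\<And>x. x \<in> {a..b} - E \<Longrightarrow> c differentiable at x"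
    and cd: "continuous_on ({a..b} - E) (\<lambda>x. vector_derivative c (at x))"
    using E(2) unfolding C1_differentiable_on_eq by auto
  have "continuous_on ({a..b} - E) (speed g c)"
    unfolding speed_def[abs_def] metric_form_sum
    by (intro continuous_intros cd continuous_on_compose2[OF smooth_fun_on_continuous[OF smooth_g]]
        continuous_on_subset[OF c(1)]) (use c in auto)
  then show thesis using that E c d vector_derivative_works by blast
qed

text \<open>Along a geodesic \<open>\<gamma>\<close> with velocity \<open>u\<close>, the right-hand side is $1 + \partial_t W + \partial_x W \cdot w$ for
  $W(t,x) = 2 g_{\gamma(t)}(u(t), x - \gamma(t)) + \kappa(t) |x - \gamma(t)|^2$ with
  $\dot\kappa = -(C U^2 + (C U + 1)^2/m)$. The quadratic term with this $\kappa$ absorbs the second-order errors.\<close>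

lemma calibration_inequality:
  assumes K: "x \<in> K" "y \<in> K" "K \<subseteq> M"
    and m: "m > 0" "\<And>x v. x \<in> K \<Longrightarrow> G x v v \<ge> m * (norm v)\<^sup>2"
    and C: "C > 0" 
    "\<And>x y v w. x \<in> K \<Longrightarrow> y \<in> K \<Longrightarrow> \<bar>G y v w - G x v w\<bar> \<le> C * norm (y - x) * norm v * norm w"
    "\<And>x y v w. x \<in> K \<Longrightarrow> y \<in> K \<Longrightarrow>
        \<bar>G y v v - G x v v - 2 * G x v (B x v (y - x))\<bar> \<le> C * (norm (y - x))\<^sup>2 * (norm v)\<^sup>2"
    and u: "norm u \<le> U" "G x u u = 1" and \<kappa>: "\<bar>\<kappa>\<bar> \<le> 1"
  shows "G y w w \<ge> 1 + 2 * G x u (B x u (y - x)) + 2 * G x u (w - u)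
     - (C * U\<^sup>2 + (C * U + 1)\<^sup>2 / m) * (norm (y - x))\<^sup>2 + 2 * \<kappa> * ((y - x) \<bullet> (w - u))"
proof -
  define k where "k = w - u"
  define h where "h = y - x"
  define H where "H = norm h"
  define N where "N = norm k"
  have w: "w = u + k" by (simp add: k_def)
  have 0: "H \<ge> 0" "N \<ge> 0" "U \<ge> 0" using order_trans[OF norm_ge_zero u(1)] by (auto simp: H_def N_def)
  have sym: "G y k u = G y u k"
    using K by (intro G_sym) auto
  have e1: "G y u u \<ge> 1 + 2 * G x u (B x u h) - C * H\<^sup>2 * U\<^sup>2"
  proof -
    have "C * H\<^sup>2 * (norm u)\<^sup>2 \<le> C * H\<^sup>2 * U\<^sup>2"
      using C(1) u(1) by (intro mult_left_mono power_mono) auto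
    then show ?thesis using C(3)[OF K(1,2), of u] u(2) unfolding H_def h_def by linarith
  qed
  have e2: "2 * G y u k \<ge> 2 * G x u k - 2 * (C * H * U * N)"
  proof -
    have "C * H * norm u * N \<le> C * H * U * N"
      using C(1) u(1) 0 by (intro mult_right_mono mult_left_mono) auto
    then show ?thesis using C(2)[OF K(1,2), of u k] unfolding H_def h_def N_def by linarith
  qed
  have e3: "G y k k \<ge> m * N\<^sup>2" using m(2)[OF K(2)] by (simp add: N_def)
  have e4: "2 * \<kappa> * (h \<bullet> k) \<le> 2 * (H * N)"
  proof -
    have "\<kappa> * (h \<bullet> k) \<le> \<bar>\<kappa>\<bar> * \<bar>h \<bullet> k\<bar>" by (metis abs_ge_self abs_mult)
    also have "\<dots> \<le> 1 * (H * N)"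
      using \<kappa> Cauchy_Schwarz_ineq2[of h k] unfolding H_def N_def by (intro mult_mono) auto
    finally show ?thesis by simp
  qed
  \<comment> \<open>Completing the square: positive definiteness supplies
    \<open>m * N\<^sup>2\<close>, which pays for both cross terms. In \<open>C * U + 1\<close> the
    summand \<open>C * U\<close> stems from the variation of the metric and 1 from the quadratic
    term of the calibration.\<close>
  have "0 \<le> (m * N - (C * U + 1) * H)\<^sup>2 / m" using m by simp
  also have "\<dots> = m * N\<^sup>2 - 2 * (C * U + 1) * H * N + (C * U + 1)\<^sup>2 / m * H\<^sup>2"
    using m by (simp add: field_simps power2_eq_square)
  finally have e5: "0 \<le> m * N\<^sup>2 - 2 * (C * H * U * N) - 2 * (H * N) + (C * U + 1)\<^sup>2 / m * H\<^sup>2"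
    by (simp add: algebra_simps)
  have "G y w w = G y u u + 2 * G y u k + G y k k"
    by (simp add: w metric_form_bilinear_simps sym)
  then show ?thesis using e1 e2 e3 e4 e5
    unfolding h_def[symmetric] k_def[symmetric] H_def[symmetric] by (simp add: algebra_simps)
qed

lemma speed_le_of_linear:
  assumes "c s \<in> K" "K \<subseteq> M" and m: "m > 0" "\<And>x v. x \<in> K \<Longrightarrow> G x v v \<ge> m * (norm v)\<^sup>2"
  shows "sqrt m * norm (vector_derivative c (at s)) \<le> speed g c s"
proof -
  have "sqrt m * norm (vector_derivative c (at s)) = sqrt (m * (norm (vector_derivative c (at s)))\<^sup>2)"
    by (simp add: real_sqrt_mult)
  also have "\<dots> \<le> speed g c s"
    unfolding speed_def using m(2)[OF assms(1)] by (intro real_sqrt_le_mono)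
  finally show ?thesis .
qed

text \<open>Up to the first time at distance \<open>R\<close> the speed dominates
  \<open>sqrt m\<close> times the Euclidean speed, and the Euclidean displacement until then is at
  least \<open>R - r\<close>.\<close>

lemma leaving_curve_length:
  assumes adm: "admissible_curve M g c a b" and R: "cball p R \<subseteq> M"
    and m: "m > 0" "\<And>x v. x \<in> cball p R \<Longrightarrow> G x v v \<ge> m * (norm v)\<^sup>2"
    and ca: "dist p (c a) \<le> r" and leave: "\<exists>s\<in>{a..b}. c s \<notin> cball p R"
  shows "sqrt m * (R - r) \<le> arc_length g c a b"
proof -
  obtain E where E: "finite E" "continuous_on {a..b} c"
    "\<And>s. s \<in> {a..b} - E \<Longrightarrow> (c has_vector_derivative vector_derivative c (at s)) (at s)"
    using admissible_curve_derivative[OF adm] by metis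
  define X where "X = {s \<in> {a..b}. R \<le> dist p (c s)}"
  have "closed X"
    unfolding X_def by (intro continuous_on_closed_Collect_le continuous_intros E(2) closed_real_atLeastAtMost)
  moreover have "bounded X" unfolding X_def by (rule bounded_subset[of "{a..b}"]) auto
  ultimately have "compact X" by (simp add: compact_eq_bounded_closed)
  moreover have "X \<noteq> {}" using leave by (force simp: X_def)
  ultimately obtain b' where b': "b' \<in> X" "\<And>s. s \<in> X \<Longrightarrow> b' \<le> s"
    by (metis compact_attains_inf)
  have ab: "a \<le> b'" "b' \<le> b" "R \<le> dist p (c b')" using b' by (auto simp: X_def)
  have inK: "c s \<in> cball p R" if "s \<in> {a<..<b'}" for s
    using b'(2)[of s] that ab by (force simp: X_def)
  \<comment> \<open>The unit direction of the displacement; \<open>sgn 0 = 0\<close> covers a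
    vanishing displacement. The linear function given by \<open>e\<close> calibrates the straight
    line.\<close>
  define e where "e = sgn (c b' - c a)"
  define F where "F s = sqrt m * (e \<bullet> c s)" for s
  have "F b' - F a \<le> arc_length g c a b"
  proof (rule arc_length_ge[OF adm ab(1,2) _ E(1)])
    show "continuous_on {a..b'} F" unfolding F_def
      using ab by (intro continuous_intros continuous_on_subset[OF E(2)]) auto
    fix s assume s: "s \<in> {a<..<b'} - E"
    then have d: "(c has_vector_derivative vector_derivative c (at s)) (at s)"
      using E(3)[of s] ab by auto
    have "(F has_real_derivative sqrt m * (e \<bullet> vector_derivative c (at s))) (at s)"
      using bounded_linear.has_vector_derivative[OF bounded_linear_inner_right d, of e]
      unfolding F_def by (auto simp: has_real_derivative_iff_has_vector_derivative[symmetric] intro!: DERIV_cmult)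
    moreover have "sqrt m * (e \<bullet> vector_derivative c (at s)) \<le> speed g c s"
    proof -
      have "e \<bullet> vector_derivative c (at s) \<le> norm e * norm (vector_derivative c (at s))"
        by (rule norm_cauchy_schwarz)
      also have "\<dots> \<le> 1 * norm (vector_derivative c (at s))"
        by (intro mult_right_mono) (auto simp: e_def norm_sgn)
      finally have "sqrt m * (e \<bullet> vector_derivative c (at s)) \<le> sqrt m * norm (vector_derivative c (at s))"
        using m by (intro mult_left_mono) auto
      then show ?thesis using speed_le_of_linear[where c=c and s=s, OF _ R m] inK[of s] s by fastforce
    qed
    ultimately show "(F has_real_derivative sqrt m * (e \<bullet> vector_derivative c (at s))) (at s) \<and>
      sqrt m * (e \<bullet> vector_derivative c (at s)) \<le> speed g c s" by blast
  qed
  moreover have "F b' - F a = sqrt m * norm (c b' - c a)"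
  proof -
    have "e \<bullet> (c b' - c a) = norm (c b' - c a)"
      by (cases "c b' = c a") (simp_all add: e_def sgn_div_norm dot_square_norm power2_eq_square)
    then show ?thesis by (simp add: F_def inner_diff_right flip: right_diff_distrib)
  qed
  moreover have "R - r \<le> norm (c b' - c a)"
    using ab(3) ca dist_triangle[of p "c b'" "c a"] by (simp add: dist_norm norm_minus_commute)
  then have "sqrt m * (R - r) \<le> sqrt m * norm (c b' - c a)"
    using m by (intro mult_left_mono) auto
  ultimately show ?thesis by linarith
qed

text \<open>A competitor \<open>c\<close> of length less than $2\tau$ is compared with the geodesic at the time \<open>T s\<close>, where
  $T' = \mathrm{speed} + \epsilon$ and $\epsilon$ is chosen such that \<open>T\<close> ends exactly at \<open>\<tau>\<close>. The calibration inequality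
  is homogenised by the factor $T'$, and $\mathrm{speed}^2 / T' \le \mathrm{speed}$; so \<open>c\<close> itself need not be reparametrized.\<close>

lemma calibrated_length:
  assumes K: "K \<subseteq> M"
    and m: "m > 0" "\<And>x v. x \<in> K \<Longrightarrow> G x v v \<ge> m * (norm v)\<^sup>2"
    and C: "C > 0" 
    "\<And>x y v w. x \<in> K \<Longrightarrow> y \<in> K \<Longrightarrow> \<bar>G y v w - G x v w\<bar> \<le> C * norm (y - x) * norm v * norm w"
    "\<And>x y v w. x \<in> K \<Longrightarrow> y \<in> K \<Longrightarrow>
        \<bar>G y v v - G x v v - 2 * G x v (B x v (y - x))\<bar> \<le> C * (norm (y - x))\<^sup>2 * (norm v)\<^sup>2"
    and \<tau>: "\<tau> > 0" "(C * U\<^sup>2 + (C * U + 1)\<^sup>2 / m) * \<tau> \<le> 1"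
    and \<gamma>: "\<And>t. \<bar>t\<bar> \<le> \<tau> \<Longrightarrow> \<gamma> t \<in> K" "\<And>t. \<bar>t\<bar> \<le> \<tau> \<Longrightarrow> norm (u t) \<le> U"
      "\<And>t. \<bar>t\<bar> \<le> \<tau> \<Longrightarrow> G (\<gamma> t) (u t) (u t) = 1"
      "\<And>t. \<bar>t\<bar> \<le> \<tau> \<Longrightarrow> (\<gamma> has_vector_derivative u t) (at t)"
      "\<And>t. \<bar>t\<bar> \<le> \<tau> \<Longrightarrow> (u has_vector_derivative - B (\<gamma> t) (u t) (u t)) (at t)"
    and adm: "admissible_curve M g c a b" and "a < b" and cK: "\<And>s. s \<in> {a..b} \<Longrightarrow> c s \<in> K"
    and ends: "c a = \<gamma> (- \<tau>)" "c b = \<gamma> \<tau>"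
  shows "2 * \<tau> \<le> arc_length g c a b"
proof (rule ccontr)
  define lam where "lam = C * U\<^sup>2 + (C * U + 1)\<^sup>2 / m"
  have lam: "lam \<ge> 0" "lam * \<tau> \<le> 1" using C(1) m(1) \<tau> by (auto simp: lam_def)
  assume neg: "\<not> 2 * \<tau> \<le> arc_length g c a b"
  define \<epsilon> where "\<epsilon> = (2 * \<tau> - arc_length g c a b) / (b - a)"
  have \<epsilon>: "\<epsilon> > 0" "\<epsilon> * (b - a) = 2 * \<tau> - arc_length g c a b"
    using neg \<open>a < b\<close> by (auto simp: \<epsilon>_def)
  obtain E where E: "finite E" "continuous_on {a..b} c" "continuous_on ({a..b} - E) (speed g c)"
    "\<And>s. s \<in> {a..b} - E \<Longrightarrow> (c has_vector_derivative vector_derivative c (at s)) (at s)"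
    using admissible_curve_derivative[OF adm] by metis
  define q where "q s = speed g c s + \<epsilon>" for s
  define T where "T s = - \<tau> + integral {a..s} q" for s
  have q_pos: "q s > 0" if "s \<in> {a..b}" for s
    using \<epsilon>(1) speed_nonneg[of c s] cK[OF that] K by (force simp: q_def)
  have q_int: "q integrable_on {a..b}"
    using adm unfolding q_def admissible_curve_def by (intro integrable_add integrable_const_ivl) auto
  have Tb: "T b = \<tau>" and Ta: "T a = - \<tau>"
  proof -
    have "integral {a..b} q = arc_length g c a b + \<epsilon> * (b - a)"
      unfolding q_def arc_length_def using adm \<open>a < b\<close>
      by (subst Henstock_Kurzweil_Integration.integral_add) (auto simp: admissible_curve_def mult.commute)
    then show "T b = \<tau>" using \<epsilon>(2) by (simp add: T_def)
  qed (simp add: T_def)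
  have T_in: "\<bar>T s\<bar> \<le> \<tau>" if "s \<in> {a..b}" for s
  proof -
    have s: "q integrable_on {a..s}" using q_int that by (auto intro: integrable_on_subinterval)
    have "0 \<le> integral {a..s} q"
      using q_pos that by (intro Henstock_Kurzweil_Integration.integral_nonneg s) (auto intro: less_imp_le)
    moreover have "integral {a..s} q \<le> integral {a..b} q"
      using q_pos that by (intro integral_subset_le s q_int) (auto intro: less_imp_le)
    ultimately show ?thesis using Tb by (simp add: T_def)
  qed
  have T_cont: "continuous_on {a..b} T"
    unfolding T_def by (intro continuous_intros indefinite_integral_continuous_1 q_int)
  have T_deriv: "(T has_vector_derivative q s) (at s)" if s: "s \<in> {a<..<b} - E" for s
  proof -
    have "continuous (at s within ({a..b} - E)) q"
      using E(3) s unfolding q_def by (intro continuous_intros) (auto simp: continuous_on_eq_continuous_within)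
    then have "((\<lambda>u. integral {a..u} q) has_vector_derivative q s) (at s within ({a..b} - E))"
      using s by (intro integral_has_vector_derivative_continuous_at q_int E(1)) auto
    moreover have "at s within ({a..b} - E) = at s"
      using s E(1) by (intro at_within_open_subset[of _ "{a<..<b} - E"] open_Diff finite_imp_closed) auto
    ultimately show ?thesis unfolding T_def by (auto intro!: derivative_eq_intros)
  qed
  define h where "h s = c s - \<gamma> (T s)" for s
  \<comment> \<open>\<open>F s\<close> is \<open>T s\<close> plus the calibration \<open>W\<close>
    at time \<open>T s\<close> and point \<open>c s\<close>, with
    \<open>\<kappa>(t) = - lam * t\<close>. The slope of \<open>\<kappa>\<close> is the required
    one, and \<open>lam * \<tau> \<le> 1\<close> keeps \<open>\<kappa>\<close> between -1 and 1. At
    both ends \<open>h\<close> vanishes, so \<open>F\<close> grows by exactly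
    \<open>2 * \<tau>\<close>.\<close>
  define F where "F s = T s + (2 * G (\<gamma> (T s)) (u (T s)) (h s) + (- lam * T s) * (h s \<bullet> h s))" for s
  define h' where "h' s = vector_derivative c (at s) - q s *\<^sub>R u (T s)" for s
  define F' where "F' s = q s + (2 * (q s * G (\<gamma> (T s)) (u (T s)) (B (\<gamma> (T s)) (u (T s)) (h s))
     + G (\<gamma> (T s)) (u (T s)) (h' s)) + (- lam * q s * (h s \<bullet> h s) + (- lam * T s) * (2 * (h s \<bullet> h' s))))" for s
  have \<gamma>_cont: "continuous_on {a..b} (\<lambda>s. \<gamma> (T s))" "continuous_on {a..b} (\<lambda>s. u (T s))"
  proof -
    have "continuous_on {-\<tau>..\<tau>} \<gamma>" "continuous_on {-\<tau>..\<tau>} u"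
      by (rule continuous_at_imp_continuous_on, rule ballI,
          rule has_vector_derivative_continuous[OF \<gamma>(4)] has_vector_derivative_continuous[OF \<gamma>(5)], force)+
    then show "continuous_on {a..b} (\<lambda>s. \<gamma> (T s))" "continuous_on {a..b} (\<lambda>s. u (T s))"
      using T_in by (auto intro!: continuous_on_compose2[OF _ T_cont] simp: abs_le_iff)
        (use T_in in \<open>fastforce simp: abs_le_iff\<close>)+
  qed
  have "F b - F a \<le> arc_length g c a b"
  proof (rule arc_length_ge[OF adm _ order_refl _ E(1)])
    show "continuous_on {a..b} F"
      unfolding F_def h_def metric_form_sum
      by (intro continuous_intros \<gamma>_cont E(2) T_cont continuous_on_compose2[OF smooth_fun_on_continuous[OF smooth_g]])
        (use \<gamma>(1) T_in K in auto)
    fix s assume s: "s \<in> {a<..<b} - E"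
    then have sab: "s \<in> {a..b}" by auto
    let ?t = "T s" and ?c = "vector_derivative c (at s)"
    have t: "\<bar>?t\<bar> \<le> \<tau>" and qs: "q s > 0" using T_in[OF sab] q_pos[OF sab] .
    have \<gamma>M: "\<gamma> ?t \<in> M" using \<gamma>(1)[OF t] K by auto
    have d\<gamma>: "((\<lambda>s. \<gamma> (T s)) has_vector_derivative q s *\<^sub>R u ?t) (at s)"
      using vector_diff_chain_at[OF T_deriv[OF s] \<gamma>(4)[OF t]] by (simp add: o_def)
    have du: "((\<lambda>s. u (T s)) has_vector_derivative q s *\<^sub>R (- B (\<gamma> ?t) (u ?t) (u ?t))) (at s)"
      using vector_diff_chain_at[OF T_deriv[OF s] \<gamma>(5)[OF t]] by (simp add: o_def)
    have dh: "(h has_vector_derivative h' s) (at s)"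
      unfolding h_def h'_def using s by (intro has_vector_derivative_diff E(4) d\<gamma>) auto
    have dG: "((\<lambda>s. G (\<gamma> (T s)) (u (T s)) (h s)) has_real_derivative
        q s * G (\<gamma> ?t) (u ?t) (B (\<gamma> ?t) (u ?t) (h s)) + G (\<gamma> ?t) (u ?t) (h' s)) (at s)"
      using G_compose_has_derivative[OF \<gamma>M d\<gamma> du dh]
      by (simp add: metric_form_bilinear_simps christoffel_scaleR_left metric_form_sum[of _ _ 0])
    have dhh: "((\<lambda>s. h s \<bullet> h s) has_real_derivative 2 * (h s \<bullet> h' s)) (at s)"
      using bounded_bilinear.has_vector_derivative[OF bounded_bilinear_inner dh dh]
      by (simp add: has_real_derivative_iff_has_vector_derivative inner_commute)
    have dT: "(T has_real_derivative q s) (at s)"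
      using T_deriv[OF s] by (simp add: has_real_derivative_iff_has_vector_derivative)
    have "(F has_real_derivative F' s) (at s)"
      unfolding F_def F'_def
      by (rule dT dG dhh derivative_eq_intros refl | simp)+
    moreover have "F' s \<le> speed g c s"
    proof -
      \<comment> \<open>The velocity of \<open>c\<close> measured in the time \<open>T\<close>; the
        calibration inequality compares it with \<open>u\<close>, the velocity of the geodesic in
        the same time.\<close>
      define w where "w = ?c /\<^sub>R q s"
      have c: "?c = q s *\<^sub>R w" and h's: "h' s = q s *\<^sub>R (w - u ?t)"
        using qs by (auto simp: w_def h'_def algebra_simps)
      have "\<bar>- lam * ?t\<bar> \<le> 1"
        using mult_left_mono[OF t lam(1)] lam by (simp add: abs_mult)
      from calibration_inequality[OF \<gamma>(1)[OF t] cK[OF sab] K m C \<gamma>(2)[OF t] \<gamma>(3)[OF t] this, of w]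
      have "1 + 2 * G (\<gamma> ?t) (u ?t) (B (\<gamma> ?t) (u ?t) (h s)) + 2 * G (\<gamma> ?t) (u ?t) (w - u ?t)
         - lam * (h s \<bullet> h s) + 2 * (- lam * ?t) * (h s \<bullet> (w - u ?t)) \<le> G (c s) w w" (is "?lhs \<le> _")
        by (simp add: h_def lam_def dot_square_norm)
      moreover have "F' s = q s * ?lhs"
        unfolding F'_def h's metric_form_scaleR_right inner_scaleR_right real_scaleR_def by algebra
      ultimately have "F' s \<le> q s * G (c s) w w" using qs by simp
      then have "F' s * q s \<le> q s * G (c s) w w * q s" using qs by (simp add: mult_right_mono)
      also have "\<dots> = G (c s) ?c ?c" by (simp add: c metric_form_bilinear_simps)
      also have "\<dots> = (speed g c s)\<^sup>2" using cK[OF sab] K by (simp add: speed_def G_nonneg subset_iff)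
      also have "\<dots> \<le> speed g c s * q s"
        using \<epsilon>(1) speed_nonneg[of c s] cK[OF sab] K by (auto simp: power2_eq_square q_def intro!: mult_left_mono)
      finally show ?thesis using qs by simp
    qed
    ultimately show "(F has_real_derivative F' s) (at s) \<and> F' s \<le> speed g c s" by blast
  qed (use \<open>a < b\<close> in auto)
  moreover have "F b - F a = 2 * \<tau>"
    by (simp add: F_def h_def Ta Tb ends metric_form_sum)
  ultimately show False using neg by simp
qed

lemma constant_curve:
  assumes "x \<in> M" "a \<le> b"
  shows "admissible_curve M g (\<lambda>_. x) a b" "arc_length g (\<lambda>_. x) a b = 0"
proof -
  have "speed g (\<lambda>_. x) = (\<lambda>_. 0)"
    by (simp add: speed_def fun_eq_iff metric_form_sum)
  then show "admissible_curve M g (\<lambda>_. x) a b" "arc_length g (\<lambda>_. x) a b = 0"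
    using assms by (auto simp: admissible_curve_def arc_length_def intro: C1_differentiable_imp_piecewise)
qed

lemma unit_speed_arc_length:
  assumes "unitary_parametrization g \<gamma> a b" "a \<le> t1" "t1 \<le> t2" "t2 \<le> b"
  shows "arc_length g \<gamma> t1 t2 = t2 - t1" "speed g \<gamma> integrable_on {t1..t2}"
proof -
  have "speed g \<gamma> t = 1" if "t \<in> {t1..t2}" for t
    using assms that by (auto simp: unitary_parametrization_def speed_def)
  then have "(speed g \<gamma> has_integral (t2 - t1)) {t1..t2}"
    using has_integral_const_real[of "1::real" t1 t2] assms by (subst has_integral_cong) auto
  then show "arc_length g \<gamma> t1 t2 = t2 - t1" "speed g \<gamma> integrable_on {t1..t2}"
    unfolding arc_length_def by (auto simp: integral_unique has_integral_integrable)
qed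

lemma short_geodesic_exists:
  assumes p: "p \<in> M" and v: "G p v v = 1"
  obtains \<tau> \<gamma> u where "\<tau> > 0" "\<gamma> 0 = p" "u 0 = v" 
    "\<And>t. \<bar>t\<bar> \<le> \<tau> \<Longrightarrow> \<gamma> t \<in> M"
    "\<And>t. \<bar>t\<bar> \<le> \<tau> \<Longrightarrow> (\<gamma> has_vector_derivative u t) (at t)"
    "\<And>t. \<bar>t\<bar> \<le> \<tau> \<Longrightarrow> (u has_vector_derivative - B (\<gamma> t) (u t) (u t)) (at t)"
    "geodesic M g \<gamma> (- \<tau>) \<tau>" "unitary_parametrization g \<gamma> (- \<tau>) \<tau>"
proof -
  obtain R where R: "R > 0" "cball p R \<subseteq> M" using p open_M open_contains_cball by blast
  obtain m where m: "m > 0" "\<And>x v. x \<in> cball p R \<Longrightarrow> G x v v \<ge> m * (norm v)\<^sup>2"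
    using G_positive_on_compact[OF compact_cball R(2)] by blast
  obtain C where C: "C > 0" 
    "\<And>x y v w. x \<in> cball p R \<Longrightarrow> y \<in> cball p R \<Longrightarrow> \<bar>G y v w - G x v w\<bar> \<le> C * norm (y - x) * norm v * norm w"
    "\<And>x y v w. x \<in> cball p R \<Longrightarrow> y \<in> cball p R \<Longrightarrow>
        \<bar>G y v v - G x v v - 2 * G x v (B x v (y - x))\<bar> \<le> C * (norm (y - x))\<^sup>2 * (norm v)\<^sup>2"
    using G_estimates_on_compact[OF compact_cball convex_cball R(2)] by blast
  obtain \<delta> \<gamma> u where \<gamma>: "\<delta> > 0" "\<gamma> 0 = p" "u 0 = v" "\<And>t. \<bar>t\<bar> < \<delta> \<Longrightarrow> \<gamma> t \<in> M"
    "\<And>t. \<bar>t\<bar> < \<delta> \<Longrightarrow> (\<gamma> has_vector_derivative u t) (at t)"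
    "\<And>t. \<bar>t\<bar> < \<delta> \<Longrightarrow> (u has_vector_derivative - B (\<gamma> t) (u t) (u t)) (at t)"
    by (rule geodesic_equation_solvable[OF p, of v]) (rule that, assumption+)
  \<comment> \<open>The velocity is parallel along its own curve, so its length is
    conserved.\<close>
  have unit: "G (\<gamma> t) (u t) (u t) = 1" if "\<bar>t\<bar> < \<delta>" for t
  proof -
    have "\<exists>c. \<forall>t\<in>{-\<delta><..<\<delta>}. G (\<gamma> t) (u t) (u t) = c"
    proof (rule has_field_derivative_zero_constant)
      fix t assume "t \<in> {-\<delta><..<\<delta>}"
      then have "\<bar>t\<bar> < \<delta>" by auto
      from G_compose_has_derivative[OF \<gamma>(4,5,6,6)[OF this]]
      have "((\<lambda>t. G (\<gamma> t) (u t) (u t)) has_real_derivative 0) (at t)"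
        by (simp add: metric_form_sum)
      then show "((\<lambda>t. G (\<gamma> t) (u t) (u t)) has_real_derivative 0) (at t within {-\<delta><..<\<delta>})"
        by (rule has_field_derivative_at_within)
    qed simp
    then obtain c where c: "\<And>t. t \<in> {-\<delta><..<\<delta>} \<Longrightarrow> G (\<gamma> t) (u t) (u t) = c" by blast
    have "t \<in> {-\<delta><..<\<delta>}" "0 \<in> {-\<delta><..<\<delta>}" using that \<gamma>(1) by auto
    then show ?thesis using c[of t] c[of 0] \<gamma>(2,3) v by simp
  qed
  have u_cont: "continuous_on {-\<delta>/2..\<delta>/2} u"
    by (rule continuous_at_imp_continuous_on, rule ballI,
        rule has_vector_derivative_continuous[OF \<gamma>(6)]) (use \<gamma>(1) in auto)
  have "bounded (u ` {-\<delta>/2..\<delta>/2})"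
    by (intro compact_imp_bounded compact_continuous_image u_cont) auto
  then obtain U where U: "U > 0" "\<And>t. \<bar>t\<bar> \<le> \<delta> / 2 \<Longrightarrow> norm (u t) \<le> U"
  proof -
    assume *: "\<And>U. U > 0 \<Longrightarrow> (\<And>t. \<bar>t\<bar> \<le> \<delta> / 2 \<Longrightarrow> norm (u t) \<le> U) \<Longrightarrow> thesis"
    from \<open>bounded _\<close> obtain U where U: "U > 0" "\<And>x. x \<in> u ` {-\<delta>/2..\<delta>/2} \<Longrightarrow> norm x \<le> U"
      unfolding bounded_pos by blast
    have "norm (u t) \<le> U" if "\<bar>t\<bar> \<le> \<delta> / 2" for t
      using that by (intro U(2) imageI) auto
    with U(1) show thesis by (rule *)
  qed
  define lam where "lam = C * U\<^sup>2 + (C * U + 1)\<^sup>2 / m"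
  have lam: "lam \<ge> 0" using C(1) m(1) by (auto simp: lam_def)
  \<comment> \<open>The four bounds serve, in this order: to stay where the solution exists and
    \<open>U\<close> bounds its velocity; to have \<open>lam * \<tau> \<le> 1\<close> in the
    calibration; to keep \<open>\<gamma>\<close> in the ball of radius \<open>R / 2\<close>; and to
    make \<open>2 * \<tau>\<close> at most \<open>sqrt m * (R - R / 2)\<close>, the least length of
    a competitor that leaves the ball of radius \<open>R\<close>.\<close>
  define \<tau> where "\<tau> = Min {\<delta> / 2, 1 / (lam + 1), R / (2 * U), sqrt m * R / 4}"
  have \<tau>_le: "\<tau> \<le> \<delta> / 2" "\<tau> \<le> 1 / (lam + 1)" "\<tau> \<le> R / (2 * U)" "\<tau> \<le> sqrt m * R / 4"
    by (auto simp: \<tau>_def)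
  have \<tau>0: "\<tau> > 0" using \<gamma>(1) lam R(1) U(1) m(1) by (auto simp: \<tau>_def)
  have \<tau>_lam: "lam * \<tau> \<le> 1"
  proof -
    have "\<tau> * (lam + 1) \<le> 1" using \<tau>_le(2) lam by (simp add: field_simps)
    then show ?thesis using \<tau>0 by (simp add: algebra_simps)
  qed
  have inR: "dist p (\<gamma> t) \<le> R / 2" if t: "\<bar>t\<bar> \<le> \<tau>" for t
  proof -
    have "norm (\<gamma> t - \<gamma> 0) \<le> U * norm (t - 0)"
    proof (rule differentiable_bound[of "{-\<tau>..\<tau>}" \<gamma> "\<lambda>s x. x *\<^sub>R u s"])
      fix s assume s: "s \<in> {-\<tau>..\<tau>}"
      then have s': "\<bar>s\<bar> < \<delta>" "\<bar>s\<bar> \<le> \<delta> / 2" using \<tau>_le(1) \<gamma>(1) by auto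
      show "(\<gamma> has_derivative (\<lambda>x. x *\<^sub>R u s)) (at s within {-\<tau>..\<tau>})"
        using \<gamma>(5)[OF s'(1)] by (simp add: has_vector_derivative_def has_derivative_at_withinI)
      show "onorm (\<lambda>x. x *\<^sub>R u s) \<le> U"
        using U(2)[OF s'(2)] by (intro onorm_le) (simp add: mult.commute[of U] mult_left_mono)
    qed (use t \<tau>0 in auto)
    also have "\<dots> \<le> U * \<tau>" using t U(1) by (intro mult_left_mono) auto
    also have "\<dots> \<le> R / 2" using \<tau>_le(3) U(1) by (simp add: field_simps)
    finally show ?thesis using \<gamma>(2) by (simp add: dist_norm norm_minus_commute)
  qed
  have \<tau>: "\<bar>t\<bar> < \<delta>" "\<bar>t\<bar> \<le> \<delta> / 2" if "\<bar>t\<bar> \<le> \<tau>" for t using that \<tau>_le(1) \<gamma>(1) by auto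
  have \<gamma>K: "\<gamma> t \<in> cball p R" if "\<bar>t\<bar> \<le> \<tau>" for t using inR[OF that] R(1) by auto
  have vd: "vector_derivative \<gamma> (at t) = u t" if "\<bar>t\<bar> \<le> \<tau>" for t
    using \<gamma>(5)[OF \<tau>(1)[OF that]] by (rule vector_derivative_at)
  have C1: "\<gamma> C1_differentiable_on {-\<tau>..\<tau>}"
    unfolding C1_differentiable_on_def
  proof (intro exI conjI ballI)
    show "continuous_on {-\<tau>..\<tau>} u" by (rule continuous_on_subset[OF u_cont]) (use \<tau>_le(1) in auto)
    show "(\<gamma> has_vector_derivative u t) (at t)" if "t \<in> {-\<tau>..\<tau>}" for t
      using that by (intro \<gamma>(5) \<tau>) auto
  qed
  have unitary: "unitary_parametrization g \<gamma> (-\<tau>) \<tau>"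
    unfolding unitary_parametrization_def using C1 vd unit \<tau>(1) by (auto simp: abs_le_iff)
  have adm: "admissible_curve M g \<gamma> (-\<tau>) \<tau>"
    unfolding admissible_curve_def 
    using \<tau>0 C1 \<gamma>(4) \<tau>(1) unit_speed_arc_length(2)[OF unitary order_refl _ order_refl]
    by (auto intro: C1_differentiable_imp_piecewise simp: abs_le_iff)
  have shortest: "2 * \<tau> \<le> arc_length g c a b"
    if c: "admissible_curve M g c a b" "c a = \<gamma> (- \<tau>)" "c b = \<gamma> \<tau>" "a < b" for c a b
  proof (cases "\<exists>s\<in>{a..b}. c s \<notin> cball p R")
    case True
    have "dist p (c a) \<le> R / 2" using inR[of "-\<tau>"] \<tau>0 c(2) by simp
    then have "sqrt m * (R - R / 2) \<le> arc_length g c a b"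
      by (intro leaving_curve_length[OF c(1) R(2) m(1) m(2) _ True])
    moreover have "2 * \<tau> \<le> sqrt m * (R - R / 2)" using \<tau>_le(4) by (simp add: algebra_simps)
    ultimately show ?thesis by linarith
  next
    case False
    show ?thesis
    proof (rule calibrated_length[OF R(2) m C \<tau>0 _ \<gamma>K _ _ _ _ c(1,4) _ c(2,3), of U])
      show "(C * U\<^sup>2 + (C * U + 1)\<^sup>2 / m) * \<tau> \<le> 1" using \<tau>_lam by (simp add: lam_def)
    qed (use False U(2) unit \<gamma>(5,6) \<tau> in blast)+
  qed
  have "geodesic M g \<gamma> (- \<tau>) \<tau>"
    unfolding geodesic_def
  proof (intro conjI ballI adm)
    fix L assume "L \<in> curve_lengths M g (\<gamma> (- \<tau>)) (\<gamma> \<tau>)"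
    then obtain c a b where c: "L = arc_length g c a b" "admissible_curve M g c a b" "c a = \<gamma> (- \<tau>)" "c b = \<gamma> \<tau>"
      by (auto simp: curve_lengths_def)
    have "2 * \<tau> \<le> L"
    proof (cases "a < b")
      case True
      then show ?thesis using shortest c by blast
    next
      case False
      \<comment> \<open>A curve over a single parameter value forces equal ends. Then the constant
        curve over \<open>{0..1}\<close>, of length 0, is itself a competitor to which
        \<open>shortest\<close> applies.\<close>
      then have eq: "\<gamma> \<tau> = \<gamma> (- \<tau>)" using c by (auto simp: admissible_curve_def)
      have "\<gamma> \<tau> \<in> M" using \<gamma>K[of \<tau>] R \<tau>0 by auto
      note const = constant_curve[OF this, of 0 1]
      have "2 * \<tau> \<le> arc_length g (\<lambda>_. \<gamma> \<tau>) 0 1"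
        using const(1) by (rule shortest) (rule eq refl zero_less_one zero_le_one)+
      then have "2 * \<tau> \<le> 0" using const(2) by simp
      then show ?thesis using \<tau>0 by simp
    qed
    then show "arc_length g \<gamma> (- \<tau>) \<tau> \<le> L"
      using unit_speed_arc_length(1)[OF unitary order_refl _ order_refl] \<tau>0 by simp
  qed
  then show thesis
    by (intro that[of \<tau> \<gamma> u] \<tau>0 \<gamma>(2-6) \<tau>(1) unitary)
qed

end

section \<open>The Hessian of the information potential\<close>

lemma matrix_inv_mult_vector:
  fixes A :: "real ^ 'n ^ 'n"
  assumes "det A \<noteq> 0"
  shows "A *v (matrix_inv A *v x) = x"
proof -
  have "\<exists>A'. A ** A' = mat 1 \<and> A' ** A = mat 1"
    using assms by (simp add: invertible_det_nz[symmetric] invertible_def)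
  then have "A ** matrix_inv A = mat 1"
    unfolding matrix_inv_def by (rule someI2_ex) simp
  then show ?thesis by (simp add: matrix_vector_mul_assoc)
qed

lemma det_differentiable:
  fixes A :: "'a::real_normed_vector \<Rightarrow> real ^ 'n ^ 'n"
  assumes "\<And>i j. (\<lambda>x. A x $ i $ j) differentiable at x"
  shows "(\<lambda>x. det (A x)) differentiable at x"
proof -
  have "(\<lambda>x. \<Prod>i\<in>UNIV. A x $ i $ p i) differentiable at x" for p
  proof -
    define D where "D i = frechet_derivative (\<lambda>x. A x $ i $ p i) (at x)" for i
    have D: "((\<lambda>x. A x $ i $ p i) has_derivative D i) (at x)" for i
      unfolding D_def using assms by (simp only: frechet_derivative_works[symmetric])
    show ?thesis
      by (rule differentiableI[OF has_derivative_prod[where f = "\<lambda>i x. A x $ i $ p i" and f' = D]]) (rule D)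
  qed
  then show ?thesis
    unfolding det_def by (intro differentiable_sum differentiable_mult differentiable_const) auto
qed

text \<open>Cramer's rule presents the solution of the linear system by quotients of determinants,
  which are polynomials in the entries. The open set \<open>S\<close> is a neighbourhood on which
  these quotients are valid.\<close>

lemma matrix_inv_mult_vector_differentiable:
  fixes A :: "real ^ 'm \<Rightarrow> real ^ 'n ^ 'n" and b :: "real ^ 'm \<Rightarrow> real ^ 'n"
  assumes A: "\<And>i j. (\<lambda>x. A x $ i $ j) differentiable at x" and b: "\<And>i. (\<lambda>x. b x $ i) differentiable at x"
    and S: "open S" "x \<in> S" "\<And>y. y \<in> S \<Longrightarrow> det (A y) \<noteq> 0"
  shows "(\<lambda>x. matrix_inv (A x) *v b x) differentiable at x"
proof -
  define c where "c y k = det (\<chi> i j. if j = k then b y $ i else A y $ i $ j) / det (A y)" for y k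
  have "(\<lambda>y. c y k) differentiable at x" for k
    unfolding c_def
  proof (intro differentiable_divide det_differentiable A)
    show "(\<lambda>y. (\<chi> i j. if j = k then b y $ i else A y $ i $ j) $ i $ j) differentiable at x" for i j
      using A b by (cases "j = k") auto
  qed (use S in auto)
  then have "(\<lambda>y. \<Sum>k\<in>UNIV. c y k *\<^sub>R (axis k 1 :: real ^ 'n)) differentiable at x"
    by (intro differentiable_sum differentiable_scaleR differentiable_const) auto
  then obtain D where D: "((\<lambda>y. \<Sum>k\<in>UNIV. c y k *\<^sub>R (axis k 1 :: real ^ 'n)) has_derivative D) (at x)"
    unfolding differentiable_def by blast
  have eq: "(\<Sum>k\<in>UNIV. c y k *\<^sub>R (axis k 1 :: real ^ 'n)) = matrix_inv (A y) *v b y" if "y \<in> S" for y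
  proof -
    have "matrix_inv (A y) *v b y = (\<chi> k. c y k)"
      using cramer[OF S(3)[OF that], of "matrix_inv (A y) *v b y" "b y"]
        matrix_inv_mult_vector[OF S(3)[OF that]] by (simp add: c_def)
    then show ?thesis
      using basis_expansion[of "\<chi> k. c y k"] by (simp add: scalar_mult_eq_scaleR)
  qed
  have "((\<lambda>x. matrix_inv (A x) *v b x) has_derivative D) (at x)"
    by (rule has_derivative_transform_within_open[OF D S(1,2)]) (rule eq)
  then show ?thesis unfolding differentiable_def by blast
qed

sublocale fluctuation_geometry \<subseteq> levi_civita_metric M g \<Gamma>
  using domain metric connection by unfold_locales

context levi_civita_metric
begin

lemma G_cauchy_schwarz:
  assumes "x \<in> M"
  shows "\<bar>G x v w\<bar> \<le> sqrt (G x v v) * sqrt (G x w w)"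
proof (cases "w = 0")
  case False
  then have w: "G x w w > 0" using G_pos assms by blast
  define t where "t = G x v w / G x w w"
  have "0 \<le> G x (v - t *\<^sub>R w) (v - t *\<^sub>R w)" using G_nonneg assms by blast
  also have "\<dots> = G x v v - (G x v w)\<^sup>2 / G x w w"
    using w G_sym[OF assms, of w v] by (simp add: metric_form_bilinear_simps t_def field_simps power2_eq_square)
  finally have "(G x v w)\<^sup>2 \<le> G x v v * G x w w" using w by (simp add: field_simps)
  then have "sqrt ((G x v w)\<^sup>2) \<le> sqrt (G x v v * G x w w)" by (rule real_sqrt_le_mono)
  then show ?thesis by (simp add: real_sqrt_mult)
qed (simp add: metric_form_sum)

end

context fluctuation_geometry
begin

lemma M_connected: "connected M"
  using domain(3) by (simp add: simply_connected_imp_connected)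

text \<open>Along a short geodesic through \<open>p\<close> the dissipation is, by Axiom 3, affine
  with slope -1, while the chain rule gives its derivative as the covariant Hessian. The geodesic
  extends to both sides of \<open>p\<close>, so both derivatives are taken at an interior
  time.\<close>

lemma covariant_hessian_unit:
  assumes p: "p \<in> M" and v: "G p v v = 1"
  shows "hess S p v v - grad S p \<bullet> B p v v = - 1"
proof -
  obtain \<tau> \<gamma> u where \<gamma>: "\<tau> > 0" "\<gamma> 0 = p" "u 0 = v"
    "\<And>t. \<bar>t\<bar> \<le> \<tau> \<Longrightarrow> \<gamma> t \<in> M"
    "\<And>t. \<bar>t\<bar> \<le> \<tau> \<Longrightarrow> (\<gamma> has_vector_derivative u t) (at t)"
    "\<And>t. \<bar>t\<bar> \<le> \<tau> \<Longrightarrow> (u has_vector_derivative - B (\<gamma> t) (u t) (u t)) (at t)"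
    "geodesic M g \<gamma> (- \<tau>) \<tau>" "unitary_parametrization g \<gamma> (- \<tau>) \<tau>"
    by (rule short_geodesic_exists[OF p v]) (rule that, assumption+)
  define \<Phi> where "\<Phi> t = grad S (\<gamma> t) \<bullet> u t" for t
  have \<Phi>: "Defs.dissipation S \<gamma> t = \<Phi> t" if "\<bar>t\<bar> \<le> \<tau>" for t
    unfolding dissipation_def \<Phi>_def
    by (rule DERIV_imp_deriv smooth_compose_has_vector_derivative[OF potential_smooth domain(1)] \<gamma> that)+
  have \<Phi>_eq: "\<Phi> t = \<Phi> (- \<tau>) - (t + \<tau>)" if "t \<in> {- \<tau><..<\<tau>}" for t
  proof -
    have "arc_length g \<gamma> (- \<tau>) t = Defs.dissipation S \<gamma> (- \<tau>) - Defs.dissipation S \<gamma> t"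
      using that by (intro dissipation[OF \<gamma>(7,8)]) auto
    moreover have "arc_length g \<gamma> (- \<tau>) t = t - - \<tau>"
      using that by (intro unit_speed_arc_length(1)[OF \<gamma>(8)]) auto
    moreover have "\<bar>t\<bar> \<le> \<tau>" using that by auto
    ultimately show ?thesis using \<gamma>(1) \<Phi>[of t] \<Phi>[of "- \<tau>"] by simp
  qed
  have 0: "\<bar>0\<bar> \<le> \<tau>" using \<gamma>(1) by simp
  have "(\<Phi> has_real_derivative (hess S p v v - grad S p \<bullet> B p v v)) (at 0)"
    using smooth_grad_compose_has_derivative[OF potential_smooth domain(1) \<gamma>(4,5,6)[OF 0]] \<gamma>(2,3)
    unfolding \<Phi>_def by simp
  moreover have "(\<Phi> has_real_derivative - 1) (at 0)"
  proof -
    have "((\<lambda>t. \<Phi> (- \<tau>) - (t + \<tau>)) has_real_derivative - 1) (at 0)"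
      by (auto intro!: derivative_eq_intros)
    then show ?thesis
      by (rule has_field_derivative_transform_within_open[of _ _ _ "{- \<tau><..<\<tau>}"]) (use \<Phi>_eq \<gamma>(1) in auto)
  qed
  ultimately show ?thesis by (rule DERIV_unique)
qed

text \<open>Quadratic homogeneity passes from unit vectors to all vectors. Polarisation then uses
  the symmetry of each term: equality of mixed derivatives for \<open>hess\<close>, absence of
  torsion for \<open>B\<close>.\<close>

lemma covariant_hessian:
  assumes p: "p \<in> M"
  shows "hess S p h k - grad S p \<bullet> B p h k = - G p h k"
proof -
  define Q where "Q h k = hess S p h k - grad S p \<bullet> B p h k + G p h k" for h k
  have Q0: "Q v v = 0" for v
  proof (cases "v = 0")
    case False
    define r where "r = sqrt (G p v v)"
    have r: "r > 0" "r\<^sup>2 = G p v v" using G_pos[OF p False] by (auto simp: r_def)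
    define w where "w = v /\<^sub>R r"
    have v: "v = r *\<^sub>R w" using r by (simp add: w_def)
    have "G p w w = 1" using r(1) by (simp add: w_def metric_form_bilinear_simps power2_eq_square field_simps flip: r(2))
    then have "hess S p w w - grad S p \<bullet> B p w w = - 1" by (rule covariant_hessian_unit[OF p])
    then have "Q w w = 0" using \<open>G p w w = 1\<close> by (simp add: Q_def)
    moreover have "Q v v = r * r * Q w w"
      by (simp add: v Q_def hess_scaleR_left hess_scaleR_right metric_form_bilinear_simps
          christoffel_scaleR_left christoffel_scaleR_right algebra_simps)
    ultimately show ?thesis by simp
  qed (simp add: Q_def hess_def metric_form_sum christoffel_def inner_vec_def)
  have "Q (h + k) (h + k) = Q h h + 2 * Q h k + Q k k"
    unfolding Q_def hess_add_left hess_add_right metric_form_add_left metric_form_add_right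
      christoffel_add_left christoffel_add_right inner_add_right
    using G_sym[OF p, of k h] B_sym[OF p, of k h] hess_sym[OF potential_smooth domain(1) p, of k h]
    by simp
  then have "Q h k = 0" by (simp add: Q0)
  then show ?thesis by (simp add: Q_def)
qed

section \<open>The dual field of the differential of the potential\<close>

text \<open>The covector \<open>\<psi>\<close> with its index raised, that is, minus the Riemannian
  gradient of \<open>S\<close>.\<close>

definition "N x = matrix_inv (g x) *v psi S x"

lemma det_g: "x \<in> M \<Longrightarrow> det (g x) \<noteq> 0"
  using metric unfolding riemannian_metric_on_def by blast

lemma psi_grad: "psi S x = - grad S x"
  by (simp add: psi_def grad_def vec_eq_iff)

lemma G_N: "x \<in> M \<Longrightarrow> G x w (N x) = - (grad S x \<bullet> w)"
  by (simp add: metric_form_def N_def matrix_inv_mult_vector[OF det_g] psi_grad inner_commute)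

lemma G_N': "x \<in> M \<Longrightarrow> G x (N x) w = - (grad S x \<bullet> w)"
  using G_N G_sym by metis

lemma psi_squared_eq: "x \<in> M \<Longrightarrow> psi_squared g S x = G x (N x) (N x)"
proof -
  assume "x \<in> M"
  have "psi_squared g S x = psi S x \<bullet> N x" by (simp add: psi_squared_def N_def)
  then show ?thesis using \<open>x \<in> M\<close> by (simp add: G_N psi_grad)
qed

lemma differentiable_smooth: "smooth_fun_on M f \<Longrightarrow> x \<in> M \<Longrightarrow> f differentiable at x"
  using smooth_has_derivative_grad[OF _ domain(1), of f x UNIV] unfolding differentiable_def by blast

lemma N_differentiable: "x \<in> M \<Longrightarrow> N differentiable at x"
  unfolding N_def[abs_def]
  by (rule matrix_inv_mult_vector_differentiable[OF _ _ domain(1)], unfold psi_def vec_lambda_beta)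
    (intro differentiable_minus differentiable_smooth smooth_g smooth_fun_on_partial potential_smooth det_g | assumption)+

lemma line_has_vector_derivative: "((\<lambda>s. x + s *\<^sub>R h) has_vector_derivative h) (at s within T)"
  by (auto intro!: derivative_eq_intros)

text \<open>The Hessian equation says that the gradient field \<open>N\<close> satisfies $D_h N = h$.\<close>

lemma gaussian_potential_stationary:
  assumes x: "x \<in> M"
  shows "((\<lambda>x. S x + 1 / 2 * G x (N x) (N x)) has_derivative (\<lambda>h. 0)) (at x)"
proof -
  define T where "T x = S x + 1 / 2 * G x (N x) (N x)" for x
  have Ni: "(\<lambda>x. N x $ i) differentiable at x" for i
    using N_differentiable[OF x] differentiable_compose[of "\<lambda>x. x $ i" N x UNIV] bounded_linear_imp_differentiable[OF bounded_linear_vec_nth]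
    by auto
  have "T differentiable at x"
    unfolding T_def metric_form_sum
    by (intro differentiable_add differentiable_mult differentiable_const differentiable_sum ballI
        differentiable_smooth[OF potential_smooth x] differentiable_smooth[OF smooth_g x] Ni) auto
  then obtain T' where T': "(T has_derivative T') (at x)" unfolding differentiable_def by blast
  obtain N' where N': "(N has_derivative N') (at x)" using N_differentiable[OF x] unfolding differentiable_def by blast
  have "T' h = 0" for h
  proof -
    let ?l = "\<lambda>s::real. x + s *\<^sub>R h"
    have l: "(?l has_vector_derivative h) (at 0)" by (rule line_has_vector_derivative)
    have l': "(?l has_derivative (\<lambda>s. s *\<^sub>R h)) (at 0)" using l by (simp add: has_vector_derivative_def)
    have x0: "?l 0 \<in> M" using x by simp
    have NN: "((\<lambda>s. N (?l s)) has_vector_derivative N' h) (at 0)"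
    proof -
      have "((\<lambda>s. N (?l s)) has_derivative (\<lambda>s. N' (s *\<^sub>R h))) (at 0)"
        using has_derivative_compose[OF l', of N N'] N' by simp
      then show ?thesis
        unfolding has_vector_derivative_def
        using linear_scale[OF has_derivative_linear[OF N']] by simp
    qed
    obtain \<delta> where \<delta>: "\<delta> > 0" "\<And>s. \<bar>s\<bar> < \<delta> \<Longrightarrow> ?l s \<in> M"
    proof -
      have "open (?l -` M)" by (intro open_vimage domain continuous_intros)
      moreover have "0 \<in> ?l -` M" using x by simp
      ultimately obtain e where "e > 0" "ball 0 e \<subseteq> ?l -` M" unfolding open_contains_ball by blast
      then show thesis by (intro that[of e]) (auto simp: subset_iff dist_real_def)
    qed
    \<comment> \<open>The identity \<open>G x (N x) w = - (grad S x \<bullet> w)\<close> is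
      differentiated along the line with \<open>w\<close> constant. The terms with
      \<open>B x h w\<close> combine with \<open>hess\<close> to the covariant Hessian, which leaves
      \<open>G x h w\<close>; this is $D_h N = h$, tested with \<open>w\<close>.\<close>
    have cov: "G x (B x h (N x) + N' h) w = G x h w" for w
    proof -
      have "((\<lambda>s. G (?l s) (N (?l s)) w) has_real_derivative
         G x (B x h (N x) + N' h) w + G x (N x) (B x h w)) (at 0)"
        using G_compose_has_derivative[OF x0 l NN has_vector_derivative_const[of w]] by simp
      moreover have "((\<lambda>s. G (?l s) (N (?l s)) w) has_real_derivative - hess S x h w) (at 0)"
      proof -
        have "((\<lambda>s. - (grad S (?l s) \<bullet> w)) has_real_derivative - hess S x h w) (at 0)"
          using DERIV_minus[OF smooth_grad_compose_has_derivative[OF potential_smooth domain(1) x0 l has_vector_derivative_const[of w]]]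
          by simp
        then show ?thesis
          by (rule has_field_derivative_transform_within_open[of _ _ _ "{-\<delta><..<\<delta>}"])
            (use \<delta> in \<open>auto simp: G_N' abs_less_iff\<close>)
      qed
      ultimately have "G x (B x h (N x) + N' h) w + G x (N x) (B x h w) = - hess S x h w"
        by (rule DERIV_unique)
      then show ?thesis using covariant_hessian[OF x, of h w] G_N'[OF x, of "B x h w"] by simp
    qed
    have "((\<lambda>s. T (?l s)) has_real_derivative
        grad S x \<bullet> h + 1 / 2 * (G x (B x h (N x) + N' h) (N x) + G x (N x) (B x h (N x) + N' h))) (at 0)"
      unfolding T_def
      using smooth_compose_has_vector_derivative[OF potential_smooth domain(1) x0 l]
        G_compose_has_derivative[OF x0 l NN NN]
      by (intro DERIV_add DERIV_cmult) auto
    \<comment> \<open>Tested with \<open>N x\<close>, the equation \<open>cov\<close> turns the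
      second summand into \<open>G x h (N x)\<close>, the negative of the first.\<close>
    moreover have "grad S x \<bullet> h + 1 / 2 * (G x (B x h (N x) + N' h) (N x) + G x (N x) (B x h (N x) + N' h)) = 0"
      using cov[of "N x"] G_N[OF x, of h] G_sym[OF x, of "N x"] by simp
    moreover have "((\<lambda>s. T (?l s)) has_real_derivative T' h) (at 0)"
    proof -
      have "((\<lambda>s. T (?l s)) has_derivative (\<lambda>s. T' (s *\<^sub>R h))) (at 0)"
        using has_derivative_compose[OF l', of T T'] T' by simp
      then show ?thesis
        unfolding has_field_derivative_def
        by (rule has_derivative_eq_rhs) (simp add: linear_scale[OF has_derivative_linear[OF T']] mult.commute fun_eq_iff)
    qed
    ultimately show ?thesis by (metis DERIV_unique)
  qed
  then have "T' = (\<lambda>h. 0)" by auto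
  then show ?thesis using T' by (simp add: T_def[abs_def])
qed

lemma gaussian_potential_constant:
  assumes "max_potential_point M S p" "x \<in> M"
  shows "S x + 1 / 2 * psi_squared g S x = S p"
proof -
  have p: "p \<in> M" "grad S p = 0"
    using assms(1) by (auto simp: max_potential_point_def stationary_point_def grad_def vec_eq_iff)
  have "S x + 1 / 2 * G x (N x) (N x) = S p + 1 / 2 * G p (N p) (N p)"
    by (rule has_derivative_zero_unique_connected[OF domain(1) M_connected gaussian_potential_stationary assms(2) p(1)])
  then show ?thesis using p assms(2) by (simp add: psi_squared_eq G_N)
qed

lemma gaussian_potential_eq:
  assumes "max_potential_point M S p"
  shows "gaussian_potential M g S = S p"
  unfolding gaussian_potential_def
  using gaussian_potential_constant[OF assms] domain(2) by (intro the_equality) auto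

end

section \<open>Continuity of the Riemannian distance\<close>

context levi_civita_metric
begin

lemma arc_length_nonneg: "admissible_curve M g c a b \<Longrightarrow> arc_length g c a b \<ge> 0"
  unfolding arc_length_def
  by (intro Henstock_Kurzweil_Integration.integral_nonneg) (auto simp: admissible_curve_def intro!: speed_nonneg)

lemma curve_lengths_bdd_below: "bdd_below (curve_lengths M g P Q)"
  by (rule bdd_belowI[of _ 0]) (auto simp: curve_lengths_def arc_length_nonneg)

text \<open>The infimum of an empty set would carry no information. Points of an open connected set
  are joined by a polynomial path, whose speed is continuous and therefore integrable.\<close>

lemma curve_lengths_nonempty:
  assumes "connected M" "P \<in> M" "Q \<in> M"
  shows "curve_lengths M g P Q \<noteq> {}"
proof -
  obtain c where c: "polynomial_function c" "path_image c \<subseteq> M" "pathstart c = P" "pathfinish c = Q"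
    using connected_open_polynomial_connected[OF open_M assms] by blast
  obtain c' where c': "polynomial_function c'" "\<And>x. (c has_vector_derivative c' x) (at x)"
    using has_vector_derivative_polynomial_function[OF c(1)] by blast
  have cont: "continuous_on {0..1} c" "continuous_on {0..1} c'"
    using c c' by (auto intro: continuous_on_polymonial_function)
  have "c C1_differentiable_on {0..1}"
    unfolding C1_differentiable_on_def using c' cont by blast
  moreover have cM: "c ` {0..1} \<subseteq> M" using c(2) by (simp add: path_image_def)
  moreover have "speed g c integrable_on {0..1}"
  proof (rule integrable_continuous_real)
    show "continuous_on {0..1} (speed g c)"
      unfolding speed_def[abs_def] metric_form_sum vector_derivative_at[OF c'(2)]
      by (intro continuous_intros cont continuous_on_compose2[OF smooth_fun_on_continuous[OF smooth_g]])
        (use cM in auto)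
  qed
  ultimately have "admissible_curve M g c 0 1"
    by (simp add: admissible_curve_def C1_differentiable_imp_piecewise)
  then show ?thesis using c(3,4) by (auto simp: curve_lengths_def pathstart_def pathfinish_def)
qed

text \<open>The straight segment is traversed in the unit interval \<open>{b..b+1}\<close> with
  constant velocity \<open>z - c b\<close>, so \<open>A\<close> bounds its speed and hence its
  length.\<close>

lemma extend_curve_by_segment:
  assumes c: "admissible_curve M g c a b" and seg: "closed_segment (c b) z \<subseteq> M"
    and A: "A \<ge> 0" "\<And>w. w \<in> closed_segment (c b) z \<Longrightarrow> G w (z - c b) (z - c b) \<le> A\<^sup>2"
  obtains L where "L \<in> curve_lengths M g (c a) z" "L \<le> arc_length g c a b + A"
proof -
  let ?y = "c b"
  define l where "l t = ?y + (t - b) *\<^sub>R (z - ?y)" for t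
  define e where "e t = (if t \<le> b then c t else l t)" for t
  have ab: "a \<le> b" using c by (simp add: admissible_curve_def)
  have l_in: "l t \<in> closed_segment ?y z" if "t \<in> {b..b+1}" for t
    using that unfolding l_def closed_segment_def
    by (auto intro!: exI[of _ "t - b"] simp: algebra_simps)
  have l': "(l has_vector_derivative (z - ?y)) (at t)" for t
    unfolding l_def by (auto intro!: derivative_eq_intros)
  have lb: "l b = c b" by (simp add: l_def)
  have l_cont: "continuous_on X l" for X
    unfolding l_def by (intro continuous_intros)
  have "l piecewise_C1_differentiable_on {b..b+1}"
    by (rule C1_differentiable_imp_piecewise, unfold C1_differentiable_on_def)
      (use l' in \<open>auto intro!: exI[of _ "\<lambda>_. z - ?y"]\<close>)
  then have e_pw: "e piecewise_C1_differentiable_on {a..b + 1}"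
    unfolding e_def using c ab
    by (intro piecewise_C1_differentiable_cases)
      (auto simp: admissible_curve_def lb)
  have e_M: "e ` {a..b+1} \<subseteq> M"
    using c seg l_in by (fastforce simp: e_def admissible_curve_def)
  have sp1: "speed g e t = speed g c t" if "t < b" for t
  proof -
    have "vector_derivative e (at t) = vector_derivative c (at t)"
      by (rule vector_derivative_cong_eq)
        (use that in \<open>auto simp: e_def intro!: eventually_nhds_in_open[THEN eventually_mono, of "{..<b}"]\<close>)
    then show ?thesis using that by (simp add: speed_def e_def)
  qed
  have sp2: "speed g e t = sqrt (G (l t) (z - ?y) (z - ?y))" if "t > b" for t
  proof -
    have "vector_derivative e (at t) = vector_derivative l (at t)"
      by (rule vector_derivative_cong_eq)
        (use that in \<open>auto simp: e_def intro!: eventually_nhds_in_open[THEN eventually_mono, of "{b<..}"]\<close>)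
    then show ?thesis using that l'[THEN vector_derivative_at] by (simp add: speed_def e_def)
  qed
  \<comment> \<open>The corner at \<open>b\<close>, where \<open>e\<close> may fail to be
    differentiable, is discarded as a single point.\<close>
  have int1: "(speed g e has_integral arc_length g c a b) {a..b}"
  proof (rule has_integral_spike_finite[of "{b}"])
    show "(speed g c has_integral arc_length g c a b) {a..b}"
      unfolding arc_length_def using c by (intro integrable_integral) (simp add: admissible_curve_def)
  qed (use sp1 in auto)
  have cont2: "continuous_on {b..b+1} (\<lambda>t. sqrt (G (l t) (z - ?y) (z - ?y)))"
    unfolding metric_form_sum
    by (intro continuous_intros continuous_on_compose2[OF smooth_fun_on_continuous[OF smooth_g] l_cont])
      (use l_in seg in auto)
  define L2 where "L2 = integral {b..b+1} (\<lambda>t. sqrt (G (l t) (z - ?y) (z - ?y)))"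
  have int2: "(speed g e has_integral L2) {b..b+1}"
  proof (rule has_integral_spike_finite[of "{b}"])
    show "((\<lambda>t. sqrt (G (l t) (z - ?y) (z - ?y))) has_integral L2) {b..b+1}"
      unfolding L2_def using cont2 by (intro integrable_integral integrable_continuous_real)
  qed (use sp2 in auto)
  have "L2 \<le> integral {b..b+1} (\<lambda>_. A)"
    unfolding L2_def
  proof (rule integral_le)
    show "sqrt (G (l t) (z - ?y) (z - ?y)) \<le> A" if "t \<in> {b..b+1}" for t
      using A(1) A(2)[OF l_in[OF that]] by (intro real_le_lsqrt)
  qed (use cont2 in \<open>auto intro: integrable_continuous_real\<close>)
  then have L2: "L2 \<le> A" by simp
  have int: "(speed g e has_integral (arc_length g c a b + L2)) {a..b+1}"
    by (rule has_integral_combine[OF ab _ int1 int2]) simp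
  have "admissible_curve M g e a (b + 1)"
    unfolding admissible_curve_def using ab e_pw e_M int by (auto simp: has_integral_integrable)
  moreover have "e a = c a" "e (b + 1) = z" using ab by (auto simp: e_def l_def)
  moreover have "arc_length g e a (b + 1) = arc_length g c a b + L2"
    unfolding arc_length_def[of g e] using int by (rule integral_unique)
  ultimately show thesis using that[of "arc_length g e a (b + 1)"] L2
    by (force simp: curve_lengths_def)
qed

text \<open>Prolonging every curve to \<open>y\<close> by the segment and taking the infimum gives a
  triangle inequality with an explicit cost. It serves the continuity of the distance, with a crude
  \<open>A\<close>, and the descent argument, with an \<open>A\<close> that is nearly sharp for
  short segments.\<close>

lemma riemannian_distance_extend:
  assumes conn: "connected M" and xy: "x \<in> M" "y \<in> M" and seg: "closed_segment y z \<subseteq> M"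
    and A: "A \<ge> 0" "\<And>w. w \<in> closed_segment y z \<Longrightarrow> G w (z - y) (z - y) \<le> A\<^sup>2"
  shows "riemannian_distance M g x z \<le> riemannian_distance M g x y + A"
proof -
  have "riemannian_distance M g x z - A \<le> riemannian_distance M g x y"
    unfolding riemannian_distance_def[of _ _ x y]
  proof (rule cInf_greatest[OF curve_lengths_nonempty[OF conn xy]])
    fix L0 assume "L0 \<in> curve_lengths M g x y"
    then obtain c a b where c: "L0 = arc_length g c a b" "admissible_curve M g c a b" "c a = x" "c b = y"
      by (auto simp: curve_lengths_def)
    obtain L where L: "L \<in> curve_lengths M g (c a) z" "L \<le> arc_length g c a b + A"
      by (rule extend_curve_by_segment[of c a b z A]) (use c seg A in auto)
    have "riemannian_distance M g x z \<le> L"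
      unfolding riemannian_distance_def using L(1) c(3) by (intro cInf_lower curve_lengths_bdd_below) simp
    then show "riemannian_distance M g x z - A \<le> L0" using L(2) c(1) by simp
  qed
  then show ?thesis by simp
qed

lemma riemannian_distance_refl_le:
  assumes "x \<in> M"
  shows "riemannian_distance M g x x \<le> 0"
proof -
  have "0 \<in> curve_lengths M g x x"
    using constant_curve[OF assms, of 0 0] unfolding curve_lengths_def by force
  then show ?thesis unfolding riemannian_distance_def by (intro cInf_lower curve_lengths_bdd_below)
qed

lemma G_bounded_on_cball:
  assumes "cball y R \<subseteq> M" "R \<ge> 0"
  obtains C where "C > 0" "\<And>w v. w \<in> cball y R \<Longrightarrow> G w v v \<le> C * (norm v)\<^sup>2"
proof -
  obtain C1 where C1: "C1 > 0"
    "\<And>w v. w \<in> cball y R \<Longrightarrow> \<bar>G w v v - G y v v\<bar> \<le> C1 * norm (w - y) * norm v * norm v"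
    using G_estimates_on_compact[OF compact_cball convex_cball assms(1)] assms(2)
    by (metis centre_in_cball)
  obtain C2 where C2: "C2 > 0" "\<And>v. norm (G y v v) \<le> norm v * norm v * C2"
    using bounded_bilinear.pos_bounded[OF bounded_bilinear_metric_form, of g y] by blast
  show thesis
  proof
    show "C1 * R + C2 > 0" using C1(1) C2(1) assms(2) by (simp add: add_nonneg_pos)
    fix w v :: "real ^ 'n" assume w: "w \<in> cball y R"
    have "C1 * norm (w - y) * norm v * norm v \<le> C1 * R * norm v * norm v"
      using w C1(1) by (intro mult_right_mono mult_left_mono) (auto simp: dist_norm norm_minus_commute)
    then show "G w v v \<le> (C1 * R + C2) * (norm v)\<^sup>2"
      using C1(2)[OF w, of v] C2(2)[of v] by (simp add: power2_eq_square algebra_simps)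
  qed
qed

text \<open>Within a small ball a segment costs at most a constant times its Euclidean length, in
  either direction; so the distance is locally Lipschitz.\<close>

lemma riemannian_distance_continuous:
  assumes conn: "connected M" and x: "x \<in> M"
  shows "continuous_on M (riemannian_distance M g x)"
proof (rule continuous_at_imp_continuous_on, rule ballI)
  fix y assume y: "y \<in> M"
  obtain R where R: "R > 0" "cball y R \<subseteq> M" using y open_M open_contains_cball by blast
  obtain C where C: "C > 0" "\<And>w v. w \<in> cball y R \<Longrightarrow> G w v v \<le> C * (norm v)\<^sup>2"
    using G_bounded_on_cball[OF R(2)] R(1) by (metis less_imp_le)
  let ?d = "riemannian_distance M g x"
  have bd: "?d q \<le> ?d p + sqrt C * norm (q - p)" if "p \<in> cball y R" "q \<in> cball y R" for p q
  proof (rule riemannian_distance_extend[OF conn x])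
    have seg: "closed_segment p q \<subseteq> cball y R" using that by (simp add: closed_segment_subset)
    then show "closed_segment p q \<subseteq> M" using R by blast
    show "p \<in> M" using that R by blast
    show "G w (q - p) (q - p) \<le> (sqrt C * norm (q - p))\<^sup>2" if "w \<in> closed_segment p q" for w
      using C that seg by (auto simp: power_mult_distrib)
  qed (use C in auto)
  show "isCont ?d y"
    unfolding isCont_def
  proof (rule Lim_null_comparison[where g = "\<lambda>q. sqrt C * norm (q - y)", THEN LIM_zero_cancel])
    show "\<forall>\<^sub>F q in at y. norm (?d q - ?d y) \<le> sqrt C * norm (q - y)"
      using eventually_at_ball[OF R(1), of y UNIV]
    proof eventually_elim
      case (elim q)
      then have "q \<in> cball y R" "y \<in> cball y R" using R by auto
      then show ?case using bd[of q y] bd[of y q] by (simp add: norm_minus_commute)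
    qed
    show "(\<lambda>q. sqrt C * norm (q - y)) \<midarrow>y\<rightarrow> 0"
      by (auto intro!: tendsto_eq_intros)
  qed
qed

end

section \<open>The gaussian representation\<close>

context fluctuation_geometry
begin

context
  fixes p assumes max: "max_potential_point M S p"
begin

definition "radius x = sqrt (2 * (S p - S x))"

lemma p_in: "p \<in> M" and S_le: "x \<in> M \<Longrightarrow> S x \<le> S p"
  using max by (auto simp: max_potential_point_def)

lemma G_N_N: "x \<in> M \<Longrightarrow> G x (N x) (N x) = 2 * (S p - S x)"
  using gaussian_potential_constant[OF max, of x] by (simp add: psi_squared_eq)

text \<open>Uniqueness of the stationary point enters here: a zero of \<open>N\<close> is a
  stationary point of \<open>S\<close>.\<close>

lemma N_nonzero:
  assumes "x \<in> M" "x \<noteq> p"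
  shows "G x (N x) (N x) > 0"
proof (rule ccontr)
  assume "\<not> ?thesis"
  then have "N x = 0" using G_pos[OF assms(1)] by blast
  then have "grad S x \<bullet> w = 0" for w using G_N[OF assms(1), of w] by (simp add: metric_form_sum)
  then have "grad S x = 0" by (metis inner_eq_zero_iff)
  then have "stationary_point S x" by (simp add: stationary_point_def grad_def vec_eq_iff)
  then show False using max assms by (auto simp: max_potential_point_def)
qed

text \<open>By Cauchy-Schwarz the derivative of \<open>S\<close> along \<open>c\<close> is at most
  the speed times the length of \<open>N\<close>, which is \<open>radius\<close>; hence
  \<open>radius\<close> cannot drop faster than length accrues. The minus sign in \<open>F\<close>
  reflects that \<open>c\<close> runs towards \<open>p\<close>.\<close>

lemma radius_le_arc_length:
  assumes c: "admissible_curve M g c a b" "c b = p"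
  shows "radius (c a) \<le> arc_length g c a b"
proof (rule field_le_epsilon)
  fix e :: real assume e: "e > 0"
  have cM: "c s \<in> M" if "s \<in> {a..b}" for s using c that by (auto simp: admissible_curve_def)
  obtain E where E: "finite E" "continuous_on {a..b} c"
    "\<And>s. s \<in> {a..b} - E \<Longrightarrow> (c has_vector_derivative vector_derivative c (at s)) (at s)"
    using admissible_curve_derivative[OF c(1)] by metis
  \<comment> \<open>the summand \<open>e\<^sup>2\<close> keeps the square root differentiable at \<open>p\<close>\<close>
  define q where "q s = 2 * (S p - S (c s)) + e\<^sup>2" for s
  have q_pos: "q s > 0" if "s \<in> {a..b}" for s
    using S_le[OF cM[OF that]] e by (simp add: q_def add_nonneg_pos)
  define F where "F s = - sqrt (q s)" for s
  define F' where "F' s = (grad S (c s) \<bullet> vector_derivative c (at s)) / sqrt (q s)" for s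
  have ab: "a \<le> b" using c by (simp add: admissible_curve_def)
  have "F b - F a \<le> arc_length g c a b"
  proof (rule arc_length_ge[OF c(1) ab order_refl _ E(1)])
    show "continuous_on {a..b} F"
      unfolding F_def q_def using cM
      by (intro continuous_intros continuous_on_compose2[OF smooth_fun_on_continuous[OF potential_smooth] E(2)]) auto
    fix s assume s: "s \<in> {a<..<b} - E"
    then have sab: "s \<in> {a..b}" "s \<in> {a..b} - E" by auto
    let ?v = "vector_derivative c (at s)"
    have "((\<lambda>s. S (c s)) has_real_derivative grad S (c s) \<bullet> ?v) (at s)"
      by (rule smooth_compose_has_vector_derivative[OF potential_smooth domain(1) cM[OF sab(1)] E(3)[OF sab(2)]])
    then have "(q has_real_derivative - 2 * (grad S (c s) \<bullet> ?v)) (at s)"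
      unfolding q_def by (auto intro!: derivative_eq_intros)
    then have "(F has_real_derivative F' s) (at s)"
      unfolding F_def F'_def using q_pos[OF sab(1)] by (auto intro!: derivative_eq_intros simp: field_simps)
    moreover have "F' s \<le> speed g c s"
    proof -
      have "grad S (c s) \<bullet> ?v = - G (c s) ?v (N (c s))" using G_N[OF cM[OF sab(1)]] by simp
      also have "\<dots> \<le> speed g c s * sqrt (G (c s) (N (c s)) (N (c s)))"
        using G_cauchy_schwarz[OF cM[OF sab(1)], of ?v "N (c s)"] by (simp add: speed_def)
      also have "\<dots> \<le> speed g c s * sqrt (q s)"
        using speed_nonneg[of c s] cM[OF sab(1)]
        by (intro mult_left_mono real_sqrt_le_mono) (auto simp: G_N_N q_def)
      finally show ?thesis using q_pos[OF sab(1)] by (simp add: F'_def field_simps)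
    qed
    ultimately show "(F has_real_derivative F' s) (at s) \<and> F' s \<le> speed g c s" by blast
  qed
  moreover have "F b = - e" using e c(2) by (simp add: F_def q_def)
  moreover have "radius (c a) \<le> - F a" unfolding radius_def F_def q_def by simp
  ultimately show "radius (c a) \<le> arc_length g c a b + e" by simp
qed

lemma radius_le_distance:
  assumes "x \<in> M"
  shows "radius x \<le> riemannian_distance M g x p"
  unfolding riemannian_distance_def
proof (rule cInf_greatest[OF curve_lengths_nonempty[OF M_connected assms p_in]])
  fix L assume "L \<in> curve_lengths M g x p"
  then obtain c a b where "L = arc_length g c a b" "admissible_curve M g c a b" "c a = x" "c b = p"
    unfolding curve_lengths_def by blast
  then show "radius x \<le> L" using radius_le_arc_length by blast
qed

section \<open>The reverse inequality by descent\<close>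

text \<open>A non-empty open set of coordinate space cannot be compact, so the boundary conditions
  of Axiom 4 are always available.\<close>

lemma not_compact_M: "\<not> compact M"
  using domain(1,2) compact_open by blast

text \<open>Outside some compact \<open>K\<close> the weight is below \<open>exp (S x)\<close>, so
  the superlevel set is a closed part of \<open>K\<close>.\<close>

lemma superlevel_compact:
  assumes "x \<in> M"
  shows "compact {y \<in> M. S x \<le> S y}"
proof -
  obtain K where K: "compact K" "K \<subseteq> M" "\<And>y. y \<in> M - K \<Longrightarrow> \<bar>exp (S y)\<bar> < exp (S x)"
    using boundary_weight[OF not_compact_M] unfolding vanishes_at_boundary_def by (metis exp_gt_zero)
  have "{y \<in> M. S x \<le> S y} = {y \<in> K. S x \<le> S y}" using K(2,3) by force
  moreover have "closed {y \<in> K. S x \<le> S y}"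
    using K by (intro continuous_on_closed_Collect_le continuous_intros compact_imp_closed
        continuous_on_subset[OF smooth_fun_on_continuous[OF potential_smooth]]) auto
  moreover have "bounded {y \<in> K. S x \<le> S y}"
    by (rule bounded_subset[OF compact_imp_bounded[OF K(1)]]) auto
  ultimately show ?thesis by (simp add: compact_eq_bounded_closed)
qed

text \<open>Step along \<open>- N\<close>, the ascent direction of \<open>S\<close>. Minimising the functional on a compact superlevel set of \<open>S\<close>
  thus leads to \<open>p\<close>, which replaces the global gradient flow.\<close>

lemma radius_descent:
  assumes y: "y \<in> M" "y \<noteq> p" and \<theta>: "0 < \<theta>" "\<theta> < 1" and x: "x \<in> M"
  obtains z where "z \<in> M" "S y < S z"
    "radius z + \<theta> * riemannian_distance M g x z < radius y + \<theta> * riemannian_distance M g x y"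
proof -
  define r where "r = radius y"
  have r: "r > 0" "G y (N y) (N y) = r\<^sup>2" "G y (N y) (N y) > 0"
    using N_nonzero[OF y] G_N_N[OF y(1)] S_le[OF y(1)] by (auto simp: r_def radius_def)
  \<comment> \<open>Per unit of \<open>s\<close> the radius drops at a rate close to
    \<open>r\<close>, the length of \<open>N y\<close>, and the distance rises at a rate not much
    above \<open>r\<close>. The factor \<open>\<theta>\<close> leaves room for the relative errors
    \<open>\<kappa>\<close>, because \<open>\<theta> + 2 * \<kappa> < 1\<close>.\<close>
  define \<kappa> where "\<kappa> = (1 - \<theta>) / 3"
  have \<kappa>: "\<kappa> > 0" "\<theta> * (1 + \<kappa>) < 1 - \<kappa>"
  proof -
    show "\<kappa> > 0" using \<theta> by (simp add: \<kappa>_def)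
    then have "\<theta> * \<kappa> < 1 * \<kappa>" using \<theta> by (intro mult_strict_right_mono)
    moreover have "\<theta> + 2 * \<kappa> < 1" using \<theta> by (simp add: \<kappa>_def field_simps)
    ultimately show "\<theta> * (1 + \<kappa>) < 1 - \<kappa>" by (simp add: distrib_left)
  qed
  let ?l = "\<lambda>s::real. y + s *\<^sub>R (- N y)"
  have l: "(?l has_vector_derivative - N y) (at 0)" by (rule line_has_vector_derivative)
  have l0: "?l 0 \<in> M" using y by simp
  have dS: "((\<lambda>s. S (?l s)) has_real_derivative r\<^sup>2) (at 0)"
    using smooth_compose_has_vector_derivative[OF potential_smooth domain(1) l0 l] G_N[OF y(1), of "N y"] r by simp
  have r_eq: "2 * (S p - S y) = r\<^sup>2" using G_N_N[OF y(1)] r by simp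
  \<comment> \<open>The radius has derivative \<open>- r\<^sup>2 / r = - r\<close> here, so the
    added linear term leaves the negative slope \<open>- (r * \<kappa>)\<close>.\<close>
  have "((\<lambda>s. radius (?l s) + s * (r * (1 - \<kappa>))) has_real_derivative - (r * \<kappa>)) (at 0)"
    unfolding radius_def
    by (rule dS derivative_eq_intros refl | use r_eq r in \<open>simp add: field_simps power2_eq_square\<close>)+
  then obtain d1 where d1: "d1 > 0"
    "\<And>s. 0 < s \<Longrightarrow> s < d1 \<Longrightarrow> radius (?l s) + s * (r * (1 - \<kappa>)) < r"
    using DERIV_neg_dec_right[of _ "- (r * \<kappa>)" 0] r(1) \<kappa>(1) by (fastforce simp: r_def)
  have "continuous_on M (\<lambda>w. G w (N y) (N y))"
    unfolding metric_form_sum by (intro continuous_intros smooth_fun_on_continuous smooth_g)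
  then have "isCont (\<lambda>w. G w (N y) (N y)) y"
    using continuous_on_eq_continuous_at domain(1) y(1) by blast
  then have "((\<lambda>w. G w (N y) (N y)) \<longlongrightarrow> G y (N y) (N y)) (nhds y)"
    by (simp add: isCont_def tendsto_nhds_iff)
  moreover have "r\<^sup>2 < (r * (1 + \<kappa>))\<^sup>2"
    using r \<kappa> by (intro power_strict_mono) auto
  ultimately have "\<forall>\<^sub>F w in nhds y. G w (N y) (N y) < (r * (1 + \<kappa>))\<^sup>2"
    using r(2) by (auto intro: order_tendstoD)
  moreover have "\<forall>\<^sub>F w in nhds y. w \<in> M" using domain(1) y(1) by (rule eventually_nhds_in_open)
  ultimately have "\<forall>\<^sub>F w in nhds y. w \<in> M \<and> G w (N y) (N y) < (r * (1 + \<kappa>))\<^sup>2"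
    by (rule eventually_conj[rotated])
  then obtain d2 where d2: "d2 > 0" "\<And>w. dist w y < d2 \<Longrightarrow> w \<in> M \<and> G w (N y) (N y) < (r * (1 + \<kappa>))\<^sup>2"
    unfolding eventually_nhds_metric by blast
  \<comment> \<open>Half of \<open>d1\<close> makes the bound strict; the second entry keeps the
    whole segment within \<open>d2\<close> of \<open>y\<close>.\<close>
  define s where "s = min (d1 / 2) (d2 / (2 * (norm (N y) + 1)))"
  have s: "s > 0" "s < d1" "s * norm (N y) < d2"
  proof -
    show "s > 0" using d1(1) d2(1) by (auto simp: s_def add_nonneg_pos)
    show "s < d1" using d1(1) by (auto simp: s_def)
    have "s * norm (N y) \<le> s * (norm (N y) + 1)" using \<open>s > 0\<close> by (intro mult_left_mono) auto
    also have "\<dots> \<le> d2 / (2 * (norm (N y) + 1)) * (norm (N y) + 1)"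
      by (intro mult_right_mono) (auto simp: s_def)
    also have "\<dots> = d2 / 2" using norm_ge_zero[of "N y"] by (simp add: field_simps add_nonneg_eq_0_iff)
    finally show "s * norm (N y) < d2" using d2(1) by simp
  qed
  let ?z = "?l s"
  have seg: "dist w y < d2" if "w \<in> closed_segment y ?z" for w
  proof -
    have "norm (w - y) \<le> norm (?z - y)" using segment_bound1[OF that] by (simp add: norm_minus_commute)
    then show ?thesis using s by (simp add: dist_norm)
  qed
  have zM: "?z \<in> M" using d2(2)[OF seg[of ?z]] by simp
  have hz: "radius ?z + s * (r * (1 - \<kappa>)) < r" using d1(2) s by blast
  have "S y < S ?z"
  proof -
    have "0 < s * (r * (1 - \<kappa>))" using s(1) r(1) \<theta> by (intro mult_pos_pos) (auto simp: \<kappa>_def)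
    then have "radius ?z < radius y" using hz by (simp add: r_def)
    then show ?thesis by (simp add: radius_def)
  qed
  moreover have "riemannian_distance M g x ?z \<le> riemannian_distance M g x y + s * (r * (1 + \<kappa>))"
  proof (rule riemannian_distance_extend[OF M_connected x y(1)])
    show "closed_segment y ?z \<subseteq> M" using d2(2) seg by blast
    show "0 \<le> s * (r * (1 + \<kappa>))" using s r \<kappa> by simp
    fix w assume "w \<in> closed_segment y ?z"
    then have "G w (N y) (N y) \<le> (r * (1 + \<kappa>))\<^sup>2" using d2(2) seg less_imp_le by blast
    then have "s\<^sup>2 * G w (N y) (N y) \<le> s\<^sup>2 * (r * (1 + \<kappa>))\<^sup>2" by (intro mult_left_mono) auto
    then show "G w (?z - y) (?z - y) \<le> (s * (r * (1 + \<kappa>)))\<^sup>2"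
      by (simp add: metric_form_bilinear_simps power2_eq_square mult_ac)
  qed
  then have "\<theta> * riemannian_distance M g x ?z \<le> \<theta> * (riemannian_distance M g x y + s * (r * (1 + \<kappa>)))"
    using \<theta> by (intro mult_left_mono) auto
  then have "\<theta> * riemannian_distance M g x ?z \<le> \<theta> * riemannian_distance M g x y + s * r * (\<theta> * (1 + \<kappa>))"
    by (simp only: distrib_left mult_ac)
  moreover have "s * r * (\<theta> * (1 + \<kappa>)) < s * r * (1 - \<kappa>)" using s r \<kappa>(2) by simp
  ultimately show thesis using that[OF zM] hz by (simp add: r_def mult.assoc)
qed

lemma radius_continuous: "continuous_on M radius"
  unfolding radius_def by (intro continuous_intros smooth_fun_on_continuous potential_smooth)

text \<open>The superlevel set contains \<open>x\<close> and is not left by the descent step, so the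
  minimum sits at \<open>p\<close>. Its value \<open>\<theta> * riemannian_distance M g x p\<close>
  is compared with the value at \<open>x\<close>, which is at most \<open>radius x\<close>; then
  \<open>\<theta>\<close> tends to 1.\<close>

lemma distance_le_height:
  assumes x: "x \<in> M"
  shows "riemannian_distance M g x p \<le> radius x"
proof (rule field_le_mult_one_interval)
  fix \<theta> :: real assume \<theta>: "0 < \<theta>" "\<theta> < 1"
  let ?K = "{y \<in> M. S x \<le> S y}"
  let ?F = "\<lambda>y. radius y + \<theta> * riemannian_distance M g x y"
  have "continuous_on ?K ?F"
    by (intro continuous_intros continuous_on_subset[OF radius_continuous]
        continuous_on_subset[OF riemannian_distance_continuous[OF M_connected x]]) auto
  then obtain y where y: "y \<in> ?K" "\<And>z. z \<in> ?K \<Longrightarrow> ?F y \<le> ?F z"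
    using continuous_attains_inf[OF superlevel_compact[OF x], of ?F] x by blast
  have "y = p"
  proof (rule ccontr)
    assume "y \<noteq> p"
    then obtain z where "z \<in> M" "S y < S z" "?F z < ?F y"
      using radius_descent[of y \<theta> x] y(1) \<theta> x by blast
    then show False using y(1) y(2)[of z] by simp
  qed
  then have "?F p \<le> ?F x" using y x by simp
  moreover have "radius p = 0" by (simp add: radius_def)
  moreover have "\<theta> * riemannian_distance M g x x \<le> 0"
    using riemannian_distance_refl_le[OF x] \<theta> by (simp add: mult_nonneg_nonpos)
  ultimately show "\<theta> * riemannian_distance M g x p \<le> radius x" by simp
qed

lemma information_potential_eq:
  assumes "x \<in> M"
  shows "S x = gaussian_potential M g S - 1 / 2 * (riemannian_distance M g x p)\<^sup>2"
proof -
  have "riemannian_distance M g x p = radius x"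
    using radius_le_distance[OF assms] distance_le_height[OF assms] by simp
  then show ?thesis using S_le[OF assms] by (simp add: radius_def gaussian_potential_eq[OF max] field_simps)
qed

section \<open>Measurability and normalisation\<close>

lemma space_invariant_volume: "space (invariant_volume M g) = M"
  by (simp add: invariant_volume_def space_restrict_space)

lemma S_measurable: "S \<in> borel_measurable (invariant_volume M g)"
  unfolding invariant_volume_def
  using borel_measurable_continuous_on_restrict[OF smooth_fun_on_continuous[OF potential_smooth]]
  by (simp add: measurable_def space_restrict_space sets_restrict_space)

text \<open>On \<open>M\<close> the exponent equals \<open>S\<close> minus a constant, so
  measurability is inherited from \<open>S\<close>.\<close>

lemma gaussian_measurable:
  "(\<lambda>x. ennreal (exp (- (1 / 2) * (riemannian_distance M g x p)\<^sup>2))) \<in> borel_measurable (invariant_volume M g)"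
proof (rule measurable_cong[THEN iffD1])
  show "(\<lambda>x. ennreal (exp (S x - gaussian_potential M g S))) \<in> borel_measurable (invariant_volume M g)"
    using S_measurable by simp
qed (simp add: space_invariant_volume information_potential_eq)

lemma gaussian_representation:
  "distribution_of M \<rho> = density (invariant_volume M g)
     (\<lambda>x. ennreal (1 / gaussian_partition M g S * exp (- (1 / 2) * (riemannian_distance M g x p)\<^sup>2)))"
proof -
  let ?f = "\<lambda>x. 1 / gaussian_partition M g S * exp (- (1 / 2) * (riemannian_distance M g x p)\<^sup>2)"
  have eq: "exp (S x) = ?f x" if "x \<in> M" for x
  proof -
    have "1 / exp (- c) * exp d = exp (c + d)" for c d :: real
      by (simp add: exp_add exp_minus field_simps)
    then show ?thesis by (simp add: gaussian_partition_def information_potential_eq[OF that])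
  qed
  have "(\<lambda>x. ennreal (exp (S x))) \<in> borel_measurable (invariant_volume M g)"
    using S_measurable by simp
  moreover have "(\<lambda>x. ennreal (?f x)) \<in> borel_measurable (invariant_volume M g)"
    by (rule measurable_cong[THEN iffD1, OF _ calculation]) (simp only: space_invariant_volume eq)
  moreover have "AE x in invariant_volume M g. ennreal (exp (S x)) = ennreal (?f x)"
    by (rule AE_I2) (simp only: space_invariant_volume eq)
  ultimately show ?thesis unfolding potential by (rule density_cong)
qed

end
end

text \<open>Total mass 1 forces \<open>c\<close> times the integral of \<open>f\<close> to be 1. In
  the extended reals this makes the integral neither 0 nor infinite, so it can be cancelled.\<close>

lemma density_prob_scale_unique:
  assumes f: "(\<lambda>x. ennreal (f x)) \<in> borel_measurable \<mu>" "\<And>x. f x \<ge> 0" and c: "c > 0" "c' > 0"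
    and p: "prob_space (density \<mu> (\<lambda>x. ennreal (c * f x)))" "prob_space (density \<mu> (\<lambda>x. ennreal (c' * f x)))"
  shows "c = c'"
proof -
  have *: "ennreal c * (\<integral>\<^sup>+x. ennreal (f x) \<partial>\<mu>) = 1"
    if "c > 0" "prob_space (density \<mu> (\<lambda>x. ennreal (c * f x)))" for c
  proof -
    have eq: "(\<lambda>x. ennreal (c * f x)) = (\<lambda>x. ennreal c * ennreal (f x))"
      using that f(2) by (simp add: ennreal_mult)
    have "1 = emeasure (density \<mu> (\<lambda>x. ennreal (c * f x))) (space \<mu>)"
      using prob_space.emeasure_space_1[OF that(2)] by simp
    also have "\<dots> = (\<integral>\<^sup>+x. ennreal c * ennreal (f x) * indicator (space \<mu>) x \<partial>\<mu>)"
      unfolding eq using f(1) by (subst emeasure_density) auto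
    also have "\<dots> = (\<integral>\<^sup>+x. ennreal c * ennreal (f x) \<partial>\<mu>)"
      by (rule nn_integral_cong) simp
    also have "\<dots> = ennreal c * (\<integral>\<^sup>+x. ennreal (f x) \<partial>\<mu>)" using f(1) by (rule nn_integral_cmult)
    finally show ?thesis by simp
  qed
  let ?I = "\<integral>\<^sup>+x. ennreal (f x) \<partial>\<mu>"
  have "ennreal c * ?I = 1" "ennreal c' * ?I = 1" using * c p by auto
  moreover from this have "?I \<noteq> 0" "?I \<noteq> \<top>" using c by (auto simp: ennreal_mult_eq_top_iff ennreal_mult_top)
  ultimately have "ennreal c = ennreal c'"
    by (metis ennreal_mult_cancel_left mult.commute)
  then show ?thesis using c by simp
qed


theorem corollary5:
  fixes M :: "(real ^ 'n) set"
    and g :: "real ^ 'n \<Rightarrow> real ^ 'n ^ 'n"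
    and \<Gamma> :: "'n \<Rightarrow> 'n \<Rightarrow> 'n \<Rightarrow> real ^ 'n \<Rightarrow> real"
    and \<rho> S :: "real ^ 'n \<Rightarrow> real"
    and Ibar :: "real ^ 'n"
  assumes "fluctuation_geometry M g \<Gamma> \<rho> S"
    and "max_potential_point M S Ibar"
  shows "distribution_of M \<rho> = density (invariant_volume M g)
           (\<lambda>x. ennreal (1 / gaussian_partition M g S * exp (- (1 / 2) * (riemannian_distance M g x Ibar)\<^sup>2)))
       \<and> (\<forall>\<Gamma>' \<rho>' S'. fluctuation_geometry M g \<Gamma>' \<rho>' S' \<and> max_potential_point M S' Ibar
            \<longrightarrow> distribution_of M \<rho>' = distribution_of M \<rho>)"
proof (intro conjI allI impI; (elim conjE)?)
  let ?f = "\<lambda>x. exp (- (1 / 2) * (riemannian_distance M g x Ibar)\<^sup>2)"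
  note rep = fluctuation_geometry.gaussian_representation
  show *: "distribution_of M \<rho> = density (invariant_volume M g) (\<lambda>x. ennreal (1 / gaussian_partition M g S * ?f x))"
    by (rule rep[OF assms])
  fix \<Gamma>' \<rho>' S'
  assume fg': "fluctuation_geometry M g \<Gamma>' \<rho>' S'" and max': "max_potential_point M S' Ibar"
  have **: "distribution_of M \<rho>' = density (invariant_volume M g) (\<lambda>x. ennreal (1 / gaussian_partition M g S' * ?f x))"
    by (rule rep[OF fg' max'])
  \<comment> \<open>\<open>?f\<close> is built from \<open>M\<close>, \<open>g\<close> and
    \<open>Ibar\<close> only. The data \<open>\<Gamma>'\<close>, \<open>\<rho>'\<close>,
    \<open>S'\<close> enter the second representation only through the partition function, which
    normalisation determines.\<close>
  have "1 / gaussian_partition M g S' = 1 / gaussian_partition M g S"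
  proof (rule density_prob_scale_unique)
    show "(\<lambda>x. ennreal (?f x)) \<in> borel_measurable (invariant_volume M g)"
      by (rule fluctuation_geometry.gaussian_measurable[OF assms])
    show "prob_space (density (invariant_volume M g) (\<lambda>x. ennreal (1 / gaussian_partition M g S' * ?f x)))"
      using fluctuation_geometry.prob[OF fg'] unfolding ** .
    show "prob_space (density (invariant_volume M g) (\<lambda>x. ennreal (1 / gaussian_partition M g S * ?f x)))"
      using fluctuation_geometry.prob[OF assms(1)] unfolding * .
  qed (auto simp: gaussian_partition_def)
  then show "distribution_of M \<rho>' = distribution_of M \<rho>" unfolding * ** by simp
qed

end
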